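(* Let $\Omega$ be a convex domain in $\mathbf{R}^{1,1}$ containing no complete line. Then the following are equivalent: (1) $\delta_\Omega$ and $H_\Omega$ are equivalent; (2) $\delta_\Omega$ and $H_\Omega$ are quasi-isometrically equivalent; (3) $\Omega$ is Möbius equivalent to a diamond; (4) $\Omega$ is a diamond, a space component, a future, a past, or a half lightlike slab.
   Context: $\mathbf{R}^{1,1}$ is $\mathbf{R}^2$ with coordinates $(t,p)$, metric $\mathbf{b}=-dt^2+dp^2$ and time orientation $\partial_t$. A nonzero vector $v$ is lightlike if $\mathbf{b}(v,v)=0$, timelike if $\mathbf{b}(v,v)<0$. $|\cdot|$ and $d_h$ are the Euclidean norm and distance. $I^\pm(x)$ (resp. $J^\pm(x)$) denotes the open chronological (resp. closed causal) future/past of $x$. A domain is a nonempty, connected, proper open subset. Markowitz pseudodistance: let $I=(-1,1)$ and $\rho_I(s,t)=\left|\ln\frac{(s-1)(t+1)}{(s+1)(t-1)}\right|$. For a domain $\Omega$, a projectively parametrized lightlike geodesic of $\Omega$ is a curve $\gamma:I\to\Omega$, $\gamma(s)=x+h(s)v$, with $v$ lightlike and $h$ a (nonconstant) real homography without pole in $I$. Then $\delta_\Omega(x,y)=\inf\sum_{k=1}^m\rho_I(s_k,t_k)$, the infimum being over all finite families of such geodesics $\gamma_1,\dots,\gamma_m$ and points $s_k,t_k\in I$ with $\gamma_1(s_1)=x$, $\gamma_m(t_m)=y$, $\gamma_k(t_k)=\gamma_{k+1}(s_{k+1})$. Hilbert metric: for a convex domain $\Omega$ containing no complete affine line, $H_\Omega$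 is the distance obtained by integrating along piecewise smooth curves the Finsler metric $G_\Omega(v)=\frac{|v|}{d_h(x,x_v^-)}+\frac{|v|}{d_h(x,x_v^+)}$, $v\in T_x\Omega$, where $x_v^\pm$ are the endpoints of the maximal affine segment of $\Omega$ through $x$ directed by $v$ (a term is $0$ if the corresponding endpoint is at infinity). One always has $H_\Omega\le\delta_\Omega$. Equivalence: $\delta_\Omega$ and $H_\Omega$ are equivalent if there is $\alpha\ge1$ with $\delta_\Omega\le\alpha H_\Omega$; two distances $d_1,d_2$ are quasi-isometrically equivalent if there are $\alpha,\beta>0$ with $\frac1\alpha d_1-\beta\le d_2\le\alpha d_1+\beta$. Domains: a diamond is $I^+(x)\cap I^-(y)$ with $y\in I^+(x)$; a future (resp. past) is $I^+(x)$ (resp. $I^-(x)$) for some $x$; a space component is a connected component of $\mathbf{R}^{1,1}\setminus(J^+(x)\cup J^-(x))$ for some $x$; a half lightlike slab is the (nonempty) intersection of a lightlike slab (open region between two parallel lightlike lines) with $I^+(x)$ or $I^-(x)$ for some point $x$. A similarity is an affine conformal transformation $x\mapsto\lambda Ax+b$, $\lambda>0$, $A\in \mathrm{O}(1,1)$. A Möbius transformation is a composition of similarities with the Lorentzian inversion $x\mapsto x/\mathbf{b}(x,x)$ (possibly only partially defined); two domains are Möbius equivalent if such a transformation is defined on one and maps it bijectively onto the other. *)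

theory Defs
  imports "HOL-Analysis.Analysis"
begin

(* Points of R^{1,1} are pairs (t, p).  The norm and distance of the product type
   real * real are the Euclidean ones. *)
type_synonym mink = "real \<times> real"

definition mform :: "mink \<Rightarrow> mink \<Rightarrow> real" where
  "mform v w = - (fst v * fst w) + snd v * snd w"

definition lightlike :: "mink \<Rightarrow> bool" where
  "lightlike v \<longleftrightarrow> v \<noteq> 0 \<and> mform v v = 0"

definition chron_future :: "mink \<Rightarrow> mink set" where
  "chron_future x = {y. mform (y - x) (y - x) < 0 \<and> fst (y - x) > 0}"

definition chron_past :: "mink \<Rightarrow> mink set" where
  "chron_past x = {y. mform (y - x) (y - x) < 0 \<and> fst (y - x) < 0}"

definition causal_future :: "mink \<Rightarrow> mink set" where
  "causal_future x = {y. mform (y - x) (y - x) \<le> 0 \<and> fst (y - x) \<ge> 0}"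

definition causal_past :: "mink \<Rightarrow> mink set" where
  "causal_past x = {y. mform (y - x) (y - x) \<le> 0 \<and> fst (y - x) \<le> 0}"

definition domain :: "mink set \<Rightarrow> bool" where
  "domain \<Omega> \<longleftrightarrow> open \<Omega> \<and> connected \<Omega> \<and> \<Omega> \<noteq> {} \<and> \<Omega> \<noteq> UNIV"

definition contains_no_line :: "mink set \<Rightarrow> bool" where
  "contains_no_line \<Omega> \<longleftrightarrow> (\<forall>x v. v \<noteq> 0 \<longrightarrow> \<not> range (\<lambda>s::real. x + s *\<^sub>R v) \<subseteq> \<Omega>)"


subsection \<open>The Markowitz pseudodistance\<close>

definition rho_I :: "real \<Rightarrow> real \<Rightarrow> real" where
  "rho_I s t = \<bar>ln (((s - 1) * (t + 1)) / ((s + 1) * (t - 1)))\<bar>"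

(* The homography is h(s) = (a s + b) / (c s + d). *)
definition proj_lightlike_geodesic :: "mink set \<Rightarrow> (real \<Rightarrow> mink) \<Rightarrow> bool" where
  "proj_lightlike_geodesic \<Omega> \<gamma> \<longleftrightarrow>
     (\<exists>x v a b c d. lightlike v \<and> a * d - b * c \<noteq> 0 \<and>
        (\<forall>s\<in>{-1<..<1}. c * s + d \<noteq> 0 \<and> \<gamma> s = x + ((a * s + b) / (c * s + d)) *\<^sub>R v)) \<and>
     \<gamma> ` {-1<..<1} \<subseteq> \<Omega>"

definition markowitz_chain ::
  "mink set \<Rightarrow> mink \<Rightarrow> mink \<Rightarrow> nat \<Rightarrow> (nat \<Rightarrow> real \<Rightarrow> mink) \<Rightarrow> (nat \<Rightarrow> real) \<Rightarrow> (nat \<Rightarrow> real) \<Rightarrow> bool" where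
  "markowitz_chain \<Omega> x y m \<gamma> s t \<longleftrightarrow>
     1 \<le> m \<and>
     (\<forall>k\<in>{1..m}. proj_lightlike_geodesic \<Omega> (\<gamma> k) \<and> s k \<in> {-1<..<1} \<and> t k \<in> {-1<..<1}) \<and>
     \<gamma> 1 (s 1) = x \<and> \<gamma> m (t m) = y \<and>
     (\<forall>k\<in>{1..<m}. \<gamma> k (t k) = \<gamma> (Suc k) (s (Suc k)))"

(* Any two points of a domain are joined by a chain, so for x and y in a domain the
   infimum is that of a nonempty set of nonnegative reals. *)
definition markowitz :: "mink set \<Rightarrow> mink \<Rightarrow> mink \<Rightarrow> real" where
  "markowitz \<Omega> x y = Inf {\<Sum>k=1..m. rho_I (s k) (t k) | m \<gamma> s t. markowitz_chain \<Omega> x y m \<gamma> s t}"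


subsection \<open>The Hilbert metric\<close>

(* The term |v| / d(x, x_v^+) of the Finsler metric.  The endpoint x_v^+ is x + S v, where S is
   the supremum of the parameters s with x + s v in \<Omega>; it is at infinity iff these are
   unbounded above, as is also the case when v = 0.  The other endpoint x_v^- is x_{-v}^+. *)
definition hilbert_term :: "mink set \<Rightarrow> mink \<Rightarrow> mink \<Rightarrow> real" where
  "hilbert_term \<Omega> x v =
     (if bdd_above {s. x + s *\<^sub>R v \<in> \<Omega>}
      then norm v / dist x (x + Sup {s. x + s *\<^sub>R v \<in> \<Omega>} *\<^sub>R v)
      else 0)"

definition hilbert_finsler :: "mink set \<Rightarrow> mink \<Rightarrow> mink \<Rightarrow> real" where
  "hilbert_finsler \<Omega> x v = hilbert_term \<Omega> x (- v) + hilbert_term \<Omega> x v"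

(* Derivatives of all orders on the closed interval [a, b], one-sided at the endpoints;
   D n is the n-th derivative. *)
definition smooth_on_interval :: "real \<Rightarrow> real \<Rightarrow> (real \<Rightarrow> mink) \<Rightarrow> bool" where
  "smooth_on_interval a b \<gamma> \<longleftrightarrow>
     (\<exists>D :: nat \<Rightarrow> real \<Rightarrow> mink.
        (\<forall>u\<in>{a..b}. D 0 u = \<gamma> u) \<and>
        (\<forall>n. \<forall>u\<in>{a..b}. (D n has_vector_derivative D (Suc n) u) (at u within {a..b})))"

(* Smoothness is required on the closed pieces, so that the speed is bounded and the length
   integral below exists; the library's valid_path does not guarantee this. *)
definition piecewise_smooth_path :: "(real \<Rightarrow> mink) \<Rightarrow> bool" where
  "piecewise_smooth_path \<gamma> \<longleftrightarrow>
     path \<gamma> \<and>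
     (\<exists>(n::nat) \<tau>. \<tau> 0 = 0 \<and> \<tau> n = 1 \<and>
        (\<forall>i<n. \<tau> i < \<tau> (Suc i) \<and> smooth_on_interval (\<tau> i) (\<tau> (Suc i)) \<gamma>))"

(* The derivative at the finitely many break points is irrelevant to the integral. *)
definition hilbert_length :: "mink set \<Rightarrow> (real \<Rightarrow> mink) \<Rightarrow> real" where
  "hilbert_length \<Omega> \<gamma> =
     integral {0..1} (\<lambda>u. hilbert_finsler \<Omega> (\<gamma> u) (vector_derivative \<gamma> (at u)))"

definition hilbert :: "mink set \<Rightarrow> mink \<Rightarrow> mink \<Rightarrow> real" where
  "hilbert \<Omega> x y = Inf {hilbert_length \<Omega> \<gamma> | \<gamma>.
     piecewise_smooth_path \<gamma> \<and> path_image \<gamma> \<subseteq> \<Omega> \<and> pathstart \<gamma> = x \<and> pathfinish \<gamma> = y}"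


subsection \<open>Comparison of distances\<close>

(* One inequality suffices, as hilbert \<Omega> \<le> markowitz \<Omega> always holds. *)
definition markowitz_hilbert_equivalent :: "mink set \<Rightarrow> bool" where
  "markowitz_hilbert_equivalent \<Omega> \<longleftrightarrow>
     (\<exists>\<alpha>\<ge>1. \<forall>x\<in>\<Omega>. \<forall>y\<in>\<Omega>. markowitz \<Omega> x y \<le> \<alpha> * hilbert \<Omega> x y)"

definition quasi_isometrically_equivalent ::
  "'a set \<Rightarrow> ('a \<Rightarrow> 'a \<Rightarrow> real) \<Rightarrow> ('a \<Rightarrow> 'a \<Rightarrow> real) \<Rightarrow> bool" where
  "quasi_isometrically_equivalent X d1 d2 \<longleftrightarrow>
     (\<exists>\<alpha>>0. \<exists>\<beta>>0. \<forall>x\<in>X. \<forall>y\<in>X.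
        1 / \<alpha> * d1 x y - \<beta> \<le> d2 x y \<and> d2 x y \<le> \<alpha> * d1 x y + \<beta>)"


subsection \<open>Special domains\<close>

definition diamond :: "mink set \<Rightarrow> bool" where
  "diamond \<Omega> \<longleftrightarrow> (\<exists>x y. y \<in> chron_future x \<and> \<Omega> = chron_future x \<inter> chron_past y)"

definition space_component :: "mink set \<Rightarrow> bool" where
  "space_component \<Omega> \<longleftrightarrow> (\<exists>x. \<Omega> \<in> components (UNIV - (causal_future x \<union> causal_past x)))"

(* The open region between the distinct parallel lines a + R v and b + R v. *)
definition lightlike_slab :: "mink set \<Rightarrow> bool" where
  "lightlike_slab S \<longleftrightarrow>
     (\<exists>a b v. lightlike v \<and> b \<notin> range (\<lambda>s::real. a + s *\<^sub>R v) \<and>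
        S = {a + r *\<^sub>R (b - a) + s *\<^sub>R v | r s. 0 < r \<and> r < 1})"

definition half_lightlike_slab :: "mink set \<Rightarrow> bool" where
  "half_lightlike_slab \<Omega> \<longleftrightarrow> \<Omega> \<noteq> {} \<and>
     (\<exists>S x. lightlike_slab S \<and> (\<Omega> = S \<inter> chron_future x \<or> \<Omega> = S \<inter> chron_past x))"


subsection \<open>Moebius transformations\<close>

definition similarity :: "(mink \<Rightarrow> mink) \<Rightarrow> bool" where
  "similarity f \<longleftrightarrow>
     (\<exists>l A b. l > 0 \<and> linear A \<and> (\<forall>v w. mform (A v) (A w) = mform v w) \<and>
        f = (\<lambda>x. l *\<^sub>R A x + b))"

definition inversion :: "mink \<Rightarrow> mink option" where
  "inversion x = (if mform x x = 0 then None else Some (x /\<^sub>R mform x x))"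

inductive mobius :: "(mink \<Rightarrow> mink option) \<Rightarrow> bool" where
  similarity: "similarity f \<Longrightarrow> mobius (\<lambda>x. Some (f x))"
| inversion: "mobius inversion"
| comp: "mobius F \<Longrightarrow> mobius G \<Longrightarrow> mobius (F \<circ>\<^sub>m G)"

(* Symmetric in the two domains: similarities are invertible and inversion is an involution
   of its domain of definition. *)
definition mobius_equivalent :: "mink set \<Rightarrow> mink set \<Rightarrow> bool" where
  "mobius_equivalent \<Omega> \<Omega>' \<longleftrightarrow>
     (\<exists>F. mobius F \<and> \<Omega> \<subseteq> dom F \<and> bij_betw (\<lambda>x. the (F x)) \<Omega> \<Omega>')"

end

theory Submission
  imports Defs
begin

text \<open>In the null coordinates \<open>u = t + p\<close> and \<open>w = t - p\<close>, the domains of the last condition are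
  exactly the products of two open intervals different from the whole line.  A Moebius
  transformation acts on each null coordinate separately, up to exchanging them, so the domains
  Moebius equivalent to a diamond are such products as well; conversely, a translation followed by
  the inversion makes both factors bounded.

  On a product, both distances are comparable to the sum of the logarithmic variations of the
  affine functions whose positivity defines the domain.  If a convex domain is not a product, some
  ball inside it touches its boundary at a point where the tangent line is not lightlike.  Near
  that point the domain contains the ball and lies in the half plane bounded by the tangent, which
  bounds the Hilbert distance above and the Markowitz distance below, and the two are not
  comparable.\<close>

section \<open>The Hilbert metric of an open polyhedron\<close>

text \<open>Each bound is taken from the simplest domain that yields it. A null box is an open
  polyhedron, where the Finsler metric is built from the logarithmic derivatives of the wall
  functions, and bounds on both sides of the Hilbert distance can be integrated. For an arbitrary
  convex domain only one-sided estimates are wanted: an inscribed ball bounds the Finsler metric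
  from above, and a half plane bounds the cost of chains from below. Nothing is then asked of the
  boundary: the ball supplies the curvature that a smooth boundary point would have to supply.

  The link between chains and walls is that, in a projective parameter, an affine function positive
  on the domain becomes a positive homography on the interval, and \<open>rho_I\<close> dominates
  its logarithmic variation.

  Near a contact point the Hilbert distance stays bounded while the Markowitz distance becomes
  arbitrarily large. An additive constant cannot absorb this, so a single argument settles
  equivalence and quasi-isometric equivalence at once.\<close>

lemma hilbert_term_eqI:
  assumes "M \<ge> 0" and M: "\<And>s. s \<ge> 0 \<Longrightarrow> x + s *\<^sub>R v \<in> \<Omega> \<longleftrightarrow> s * M < 1"
  shows "hilbert_term \<Omega> x v = M"
proof (cases "M = 0")
  case True
  have "\<not> bdd_above {s. x + s *\<^sub>R v \<in> \<Omega>}"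
  proof
    assume "bdd_above {s. x + s *\<^sub>R v \<in> \<Omega>}"
    then obtain b where b: "\<And>s. x + s *\<^sub>R v \<in> \<Omega> \<Longrightarrow> s \<le> b"
      by (auto simp: bdd_above_def)
    have "x + (\<bar>b\<bar> + 1) *\<^sub>R v \<in> \<Omega>" using M[of "\<bar>b\<bar> + 1"] True by simp
    from b[OF this] show False by simp
  qed
  with True show ?thesis by (simp add: hilbert_term_def)
next
  case False
  with \<open>M \<ge> 0\<close> have "M > 0" by simp
  let ?S = "{s. x + s *\<^sub>R v \<in> \<Omega>}"
  have le: "s \<le> 1 / M" if "s \<in> ?S" for s
  proof (cases "s \<ge> 0")
    case True with M[of s] that \<open>M > 0\<close> show ?thesis by (auto simp: field_simps)
  next
    case False
    then show ?thesis using \<open>M > 0\<close> by (smt (verit) divide_nonneg_pos)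
  qed
  have bdd: "bdd_above ?S" using le by (auto simp: bdd_above_def)
  have "Sup ?S = 1 / M"
  proof (rule antisym)
    have "0 \<in> ?S" using M[of 0] by simp
    then show "Sup ?S \<le> 1 / M" using le by (intro cSup_least) blast+
    show "1 / M \<le> Sup ?S"
    proof (rule dense_le_bounded[of 0])
      fix s assume "0 < s" "s < 1 / M"
      then have "s \<in> ?S" using M[of s] \<open>M > 0\<close> by (simp add: field_simps)
      then show "s \<le> Sup ?S" using bdd by (rule cSup_upper)
    qed (use \<open>M > 0\<close> in simp)
  qed
  \<comment> \<open>If \<open>v\<close> were 0, the parameters 0 and \<open>1 / M\<close> would name
    the same point, once inside \<open>\<Omega>\<close> and once outside.\<close>
  moreover have "v \<noteq> 0"
    using M[of 0] M[of "1 / M"] \<open>M > 0\<close> by auto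
  ultimately show ?thesis
    using bdd \<open>M > 0\<close> by (simp add: hilbert_term_def dist_norm)
qed

section \<open>Lengths of paths and upper bounds for the Hilbert distance\<close>

lemma hilbert_finsler_nonneg: "hilbert_finsler \<Omega> x v \<ge> 0"
  by (simp add: hilbert_finsler_def hilbert_term_def)

text \<open>A speed that is not integrable gives the integral its default value 0, so the infimum
  defining the distance is bounded below in either case.\<close>

lemma hilbert_length_nonneg: "hilbert_length \<Omega> \<gamma> \<ge> 0"
  unfolding hilbert_length_def
  by (cases "(\<lambda>u. hilbert_finsler \<Omega> (\<gamma> u) (vector_derivative \<gamma> (at u))) integrable_on {0..1}")
     (auto intro: integral_nonneg hilbert_finsler_nonneg simp: not_integrable_integral)

lemma hilbert_le_length:
  assumes "piecewise_smooth_path \<gamma>" "path_image \<gamma> \<subseteq> \<Omega>"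
  shows "hilbert \<Omega> (pathstart \<gamma>) (pathfinish \<gamma>) \<le> hilbert_length \<Omega> \<gamma>"
  unfolding hilbert_def using assms
  by (intro cInf_lower bdd_belowI[of _ 0]) (auto simp: hilbert_length_nonneg)

lemma piecewise_smooth_linepath: "piecewise_smooth_path (linepath x y)"
proof -
  define D where "D n = (case n of 0 \<Rightarrow> linepath x y | Suc 0 \<Rightarrow> (\<lambda>_. y - x) | _ \<Rightarrow> (\<lambda>_. 0))"
    for n :: nat
  have "(D n has_vector_derivative D (Suc n) u) (at u within S)" for n u S
    by (auto simp: D_def has_vector_derivative_linepath_within split: nat.split)
  then have "smooth_on_interval a b (linepath x y)" for a b
    unfolding smooth_on_interval_def by (intro exI[of _ D]) (auto simp: D_def)
  then show ?thesis
    unfolding piecewise_smooth_path_def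
    by (intro conjI exI[of _ "1 :: nat"] exI[of _ "\<lambda>i. real i"]) auto
qed

text \<open>Only a majorant of the speed is integrated. Should the speed itself fail to be
  integrable, its integral is 0 by default, and \<open>I\<close> is nonnegative because the majorant
  is.\<close>

lemma hilbert_le_linepath:
  assumes seg: "closed_segment x y \<subseteq> \<Omega>"
    and f: "(f has_integral I) {0..1}"
    and le: "\<And>u. u \<in> {0..1} \<Longrightarrow> hilbert_finsler \<Omega> (linepath x y u) (y - x) \<le> f u"
  shows "hilbert \<Omega> x y \<le> I"
proof -
  have "hilbert \<Omega> x y \<le> hilbert_length \<Omega> (linepath x y)"
    using hilbert_le_length[OF piecewise_smooth_linepath, of x y \<Omega>] seg by simp
  also have "hilbert_length \<Omega> (linepath x y) =
      integral {0..1} (\<lambda>u. hilbert_finsler \<Omega> (linepath x y u) (y - x))"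
    by (simp add: hilbert_length_def)
  also have "\<dots> \<le> I"
  proof (cases "(\<lambda>u. hilbert_finsler \<Omega> (linepath x y u) (y - x)) integrable_on {0..1}")
    case True
    from has_integral_le[OF integrable_integral[OF True] f le] show ?thesis by blast
  next
    case False
    have "0 \<le> I"
      by (rule has_integral_nonneg[OF f]) (rule order_trans[OF hilbert_finsler_nonneg le])
    with False show ?thesis by (simp add: not_integrable_integral)
  qed
  finally show ?thesis .
qed

text \<open>Serves for the continuity of the gauge below; the constant \<open>a\<close> keeps the
  set nonempty, so that the induction can start from the empty index set.\<close>

lemma continuous_on_Max_insert:
  fixes f :: "'i \<Rightarrow> 'a::topological_space \<Rightarrow> real"
  assumes "finite I" "\<And>i. i \<in> I \<Longrightarrow> continuous_on S (f i)"
  shows "continuous_on S (\<lambda>x. Max (insert a ((\<lambda>i. f i x) ` I)))"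
  using assms
proof (induction I rule: finite_induct)
  case (insert j I)
  have "insert a ((\<lambda>i. f i x) ` insert j I) = insert (f j x) (insert a ((\<lambda>i. f i x) ` I))" for x
    by blast
  moreover have "Max (insert (f j x) (insert a ((\<lambda>i. f i x) ` I))) =
      max (f j x) (Max (insert a ((\<lambda>i. f i x) ` I)))" for x
    using insert.hyps(1) by (intro Max_insert) auto
  moreover have "continuous_on S (\<lambda>x. max (f j x) (Max (insert a ((\<lambda>i. f i x) ` I))))"
    using insert by (intro continuous_on_max) auto
  ultimately show ?case by (simp only:)
qed simp

text \<open>One-sided derivatives on the closed piece make the velocity continuous up to the ends,
  hence bounded; inside the piece it is the two-sided derivative that \<open>hilbert_length\<close>
  uses.\<close>

lemma smooth_on_interval_continuous_derivative:
  assumes "smooth_on_interval a b \<gamma>"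
  obtains \<gamma>' where "continuous_on {a..b} \<gamma>'"
    and "\<And>u. u \<in> {a<..<b} \<Longrightarrow> (\<gamma> has_vector_derivative \<gamma>' u) (at u)"
proof -
  from assms obtain D where D0: "\<And>u. u \<in> {a..b} \<Longrightarrow> D 0 u = \<gamma> u"
    and D: "\<And>n u. u \<in> {a..b} \<Longrightarrow> (D n has_vector_derivative D (Suc n) u) (at u within {a..b})"
    unfolding smooth_on_interval_def by blast
  show ?thesis
  proof (rule that[of "D 1"])
    show "continuous_on {a..b} (D 1)"
      using continuous_on_vector_derivative[of "{a..b}" "D 1" "D (Suc 1)"] D by simp
    fix u assume u: "u \<in> {a<..<b}"
    then have "(D 0 has_vector_derivative D 1 u) (at u within {a<..<b})"
      using has_vector_derivative_within_subset[OF D[of u 0], of "{a<..<b}"]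
        greaterThanLessThan_subseteq_atLeastAtMost_iff[of a b a b] by simp
    then have "(\<gamma> has_vector_derivative D 1 u) (at u within {a<..<b})"
      using u D0 by (intro has_vector_derivative_transform[where f = "D 0" and g = \<gamma>]) auto
    then show "(\<gamma> has_vector_derivative D 1 u) (at u)"
      using u by (simp add: at_within_open[of u "{a<..<b}"])
  qed
qed

section \<open>The gauge of an open polyhedron and logarithmic bounds\<close>

locale open_polyhedron =
  fixes I :: "'i set" and k :: "'i \<Rightarrow> mink" and c :: "'i \<Rightarrow> real" and \<Omega> :: "mink set"
  assumes finite_I: "finite I"
    and \<Omega>_eq: "\<Omega> = {x. \<forall>i\<in>I. 0 < k i \<bullet> x + c i}"
begin

text \<open>For \<open>x\<close> in \<open>\<Omega>\<close>, the Minkowski gauge of the domain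
  translated so that \<open>x\<close> is the origin: the reciprocal of the parameter at which the
  ray along \<open>v\<close> meets its first wall. The inserted 0 is the value for rays that never
  leave.\<close>

definition gauge_at :: "mink \<Rightarrow> mink \<Rightarrow> real" where
  "gauge_at x v = Max (insert 0 ((\<lambda>i. - (k i \<bullet> v) / (k i \<bullet> x + c i)) ` I))"

lemma pos: "x \<in> \<Omega> \<Longrightarrow> i \<in> I \<Longrightarrow> 0 < k i \<bullet> x + c i"
  by (simp add: \<Omega>_eq)

lemma gauge_at_nonneg: "0 \<le> gauge_at x v"
  using finite_I by (simp add: gauge_at_def)

lemma gauge_at_ge: "i \<in> I \<Longrightarrow> - (k i \<bullet> v) / (k i \<bullet> x + c i) \<le> gauge_at x v"
  using finite_I by (auto simp: gauge_at_def intro: Max_ge)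

lemma gauge_at_in: "gauge_at x v \<in> insert 0 ((\<lambda>i. - (k i \<bullet> v) / (k i \<bullet> x + c i)) ` I)"
  unfolding gauge_at_def using finite_I by (intro Max_in) auto

lemma hilbert_term_eq:
  assumes x: "x \<in> \<Omega>"
  shows "hilbert_term \<Omega> x v = gauge_at x v"
proof (rule hilbert_term_eqI[OF gauge_at_nonneg])
  fix s :: real assume s: "s \<ge> 0"
  have "0 < k i \<bullet> (x + s *\<^sub>R v) + c i \<longleftrightarrow> s * (- (k i \<bullet> v) / (k i \<bullet> x + c i)) < 1" if "i \<in> I" for i
    using pos[OF x that] by (simp add: inner_add_right field_simps) linarith
  then have "x + s *\<^sub>R v \<in> \<Omega> \<longleftrightarrow> (\<forall>i\<in>I. s * (- (k i \<bullet> v) / (k i \<bullet> x + c i)) < 1)"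
    by (simp add: \<Omega>_eq)
  also have "\<dots> \<longleftrightarrow> s * gauge_at x v < 1"
  proof
    assume "\<forall>i\<in>I. s * (- (k i \<bullet> v) / (k i \<bullet> x + c i)) < 1"
    with gauge_at_in[of x v] show "s * gauge_at x v < 1" by auto
  next
    assume "s * gauge_at x v < 1"
    with gauge_at_ge mult_left_mono[OF _ s] 
    show "\<forall>i\<in>I. s * (- (k i \<bullet> v) / (k i \<bullet> x + c i)) < 1"
      by (meson le_less_trans)
  qed
  finally show "x + s *\<^sub>R v \<in> \<Omega> \<longleftrightarrow> s * gauge_at x v < 1" .
qed

lemma hilbert_finsler_eq:
  "x \<in> \<Omega> \<Longrightarrow> hilbert_finsler \<Omega> x v = gauge_at x (- v) + gauge_at x v"
  by (simp add: hilbert_finsler_def hilbert_term_eq)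

lemma hilbert_finsler_ge:
  assumes "x \<in> \<Omega>" "i \<in> I"
  shows "\<bar>k i \<bullet> v\<bar> / (k i \<bullet> x + c i) \<le> hilbert_finsler \<Omega> x v"
proof -
  define q where "q = (k i \<bullet> v) / (k i \<bullet> x + c i)"
  have "- (k i \<bullet> - v) / (k i \<bullet> x + c i) = q" "- (k i \<bullet> v) / (k i \<bullet> x + c i) = - q"
    and q: "\<bar>k i \<bullet> v\<bar> / (k i \<bullet> x + c i) = \<bar>q\<bar>"
    using pos[OF assms] by (simp_all add: q_def abs_divide)
  then have "\<bar>q\<bar> \<le> gauge_at x (- v) + gauge_at x v"
    using gauge_at_ge[OF assms(2), of v x] gauge_at_ge[OF assms(2), of "- v" x]
      gauge_at_nonneg[of x v] gauge_at_nonneg[of x "- v"] by linarith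
  then show ?thesis using assms q by (simp add: hilbert_finsler_eq)
qed

text \<open>A maximum of nonnegative terms is at most their sum, and a wall is approached along at
  most one of \<open>v\<close> and \<open>- v\<close>; so the two gauges together count each wall
  only once.\<close>

lemma hilbert_finsler_le:
  assumes x: "x \<in> \<Omega>"
  shows "hilbert_finsler \<Omega> x v \<le> (\<Sum>i\<in>I. \<bar>k i \<bullet> v\<bar> / (k i \<bullet> x + c i))"
proof -
  have "gauge_at x v \<le> (\<Sum>i\<in>I. max 0 (- (k i \<bullet> v) / (k i \<bullet> x + c i)))" for v
    using gauge_at_in[of x v]
  proof
    assume "gauge_at x v = 0"
    then show ?thesis by (simp add: sum_nonneg)
  next
    assume "gauge_at x v \<in> (\<lambda>i. - (k i \<bullet> v) / (k i \<bullet> x + c i)) ` I"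
    then obtain i where i: "i \<in> I" "gauge_at x v = - (k i \<bullet> v) / (k i \<bullet> x + c i)" by auto
    then have "gauge_at x v \<le> max 0 (- (k i \<bullet> v) / (k i \<bullet> x + c i))" by simp
    also have "\<dots> \<le> (\<Sum>i\<in>I. max 0 (- (k i \<bullet> v) / (k i \<bullet> x + c i)))"
      by (rule member_le_sum[OF i(1)]) (auto simp: finite_I)
    finally show ?thesis .
  qed
  from add_mono[OF this[of "- v"] this[of v]]
  have "hilbert_finsler \<Omega> x v \<le> (\<Sum>i\<in>I. max 0 (- (k i \<bullet> - v) / (k i \<bullet> x + c i)) +
      max 0 (- (k i \<bullet> v) / (k i \<bullet> x + c i)))"
    using x by (simp add: hilbert_finsler_eq sum.distrib)
  also have "\<dots> = (\<Sum>i\<in>I. \<bar>k i \<bullet> v\<bar> / (k i \<bullet> x + c i))"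
  proof (rule sum.cong[OF refl])
    fix i assume "i \<in> I"
    define q where "q = (k i \<bullet> v) / (k i \<bullet> x + c i)"
    have "- (k i \<bullet> - v) / (k i \<bullet> x + c i) = q" "- (k i \<bullet> v) / (k i \<bullet> x + c i) = - q"
      "\<bar>k i \<bullet> v\<bar> / (k i \<bullet> x + c i) = \<bar>q\<bar>"
      using pos[OF x \<open>i \<in> I\<close>] by (simp_all add: q_def abs_divide)
    then show "max 0 (- (k i \<bullet> - v) / (k i \<bullet> x + c i)) + max 0 (- (k i \<bullet> v) / (k i \<bullet> x + c i)) =
        \<bar>k i \<bullet> v\<bar> / (k i \<bullet> x + c i)"
      by linarith
  qed
  finally show ?thesis .
qed

lemma convex_\<Omega>: "convex \<Omega>"
proof -
  have "\<Omega> = (\<Inter>i\<in>I. {x. - c i < k i \<bullet> x})" by (auto simp: \<Omega>_eq) (smt (verit))+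
  then show ?thesis by (auto intro!: convex_INT convex_halfspace_gt)
qed

text \<open>Along a straight segment every wall function is monotone, so the integral of the
  absolute value of its logarithmic derivative is just the absolute difference of the logarithms at
  the ends. The factor \<open>sgn\<close> in \<open>G\<close> records the direction of
  monotonicity.\<close>

lemma hilbert_le_sum:
  assumes x: "x \<in> \<Omega>" and y: "y \<in> \<Omega>"
  shows "hilbert \<Omega> x y \<le> (\<Sum>i\<in>I. \<bar>ln (k i \<bullet> y + c i) - ln (k i \<bullet> x + c i)\<bar>)"
proof -
  let ?p = "linepath x y"
  define G where "G u = (\<Sum>i\<in>I. sgn (k i \<bullet> (y - x)) * ln (k i \<bullet> ?p u + c i))" for u
  define f where "f u = (\<Sum>i\<in>I. \<bar>k i \<bullet> (y - x)\<bar> / (k i \<bullet> ?p u + c i))" for u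
  have seg: "closed_segment x y \<subseteq> \<Omega>"
    using convex_\<Omega> x y by (simp add: convex_contains_segment)
  then have p: "?p u \<in> \<Omega>" if "u \<in> {0..1}" for u
    using that linepath_in_path by (metis subsetD)
  have "(G has_vector_derivative f u) (at u within {0..1})" if u: "u \<in> {0..1}" for u
  proof -
    have "((\<lambda>u. sgn (k i \<bullet> (y - x)) * ln (k i \<bullet> ?p u + c i)) has_vector_derivative
        \<bar>k i \<bullet> (y - x)\<bar> / (k i \<bullet> ?p u + c i)) (at u within {0..1})" if i: "i \<in> I" for i
    proof -
      have "((\<lambda>u. k i \<bullet> ?p u + c i) has_vector_derivative k i \<bullet> (y - x)) (at u within {0..1})"
        by (auto intro!: derivative_eq_intros has_vector_derivative_linepath_within
            bounded_linear.has_vector_derivative[OF bounded_linear_inner_right])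
      then have "((\<lambda>u. k i \<bullet> ?p u + c i) has_real_derivative k i \<bullet> (y - x)) (at u within {0..1})"
        by (simp add: has_real_derivative_iff_has_vector_derivative)
      then have "((\<lambda>u. sgn (k i \<bullet> (y - x)) * ln (k i \<bullet> ?p u + c i)) has_real_derivative
          sgn (k i \<bullet> (y - x)) * (k i \<bullet> (y - x) / (k i \<bullet> ?p u + c i))) (at u within {0..1})"
        using DERIV_cmult[OF DERIV_chain2[where f = ln and g = "\<lambda>u. k i \<bullet> ?p u + c i",
              OF DERIV_ln_divide[OF pos[OF p[OF u] i]]]]
        by (force elim!: DERIV_cong)
      then show ?thesis
        by (simp add: has_real_derivative_iff_has_vector_derivative abs_sgn mult.commute)
    qed
    then show ?thesis unfolding G_def f_def by (intro has_vector_derivative_sum) 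
  qed
  then have "(f has_integral (G 1 - G 0)) {0..1}"
    by (intro fundamental_theorem_of_calculus) auto
  then have "hilbert \<Omega> x y \<le> G 1 - G 0"
    by (rule hilbert_le_linepath[OF seg]) (simp add: f_def hilbert_finsler_le p)
  also have "G 1 - G 0 = (\<Sum>i\<in>I. sgn (k i \<bullet> (y - x)) * (ln (k i \<bullet> y + c i) - ln (k i \<bullet> x + c i)))"
    by (simp add: G_def sum_subtractf[symmetric] right_diff_distrib linepath_0' linepath_1')
  also have "\<dots> \<le> (\<Sum>i\<in>I. \<bar>ln (k i \<bullet> y + c i) - ln (k i \<bullet> x + c i)\<bar>)"
    by (intro sum_mono) (auto simp: sgn_if)
  finally show ?thesis .
qed

lemma finsler_integrable_piece:
  assumes sm: "smooth_on_interval a b \<gamma>" and cont: "continuous_on {a..b} \<gamma>"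
    and im: "\<gamma> ` {a..b} \<subseteq> \<Omega>"
  shows "(\<lambda>u. hilbert_finsler \<Omega> (\<gamma> u) (vector_derivative \<gamma> (at u))) integrable_on {a..b}"
proof -
  obtain \<gamma>' where \<gamma>': "continuous_on {a..b} \<gamma>'"
    "\<And>u. u \<in> {a<..<b} \<Longrightarrow> (\<gamma> has_vector_derivative \<gamma>' u) (at u)"
    using smooth_on_interval_continuous_derivative[OF sm] by blast
  have nz: "k i \<bullet> \<gamma> u + c i \<noteq> 0" if "u \<in> {a..b}" "i \<in> I" for i u
    using pos[of "\<gamma> u" i] im that by force
  have "continuous_on {a..b} (\<lambda>u. gauge_at (\<gamma> u) (- \<gamma>' u) + gauge_at (\<gamma> u) (\<gamma>' u))"
    unfolding gauge_at_def using nz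
    by (intro continuous_on_add continuous_on_Max_insert finite_I continuous_intros cont \<gamma>'(1)) auto
  then have "(\<lambda>u. gauge_at (\<gamma> u) (- \<gamma>' u) + gauge_at (\<gamma> u) (\<gamma>' u)) integrable_on {a..b}"
    by (rule integrable_continuous_real)
  then show ?thesis
  proof (rule integrable_spike_finite[of "{a, b}", rotated 2])
    fix u assume "u \<in> {a..b} - {a, b}"
    then have "u \<in> {a<..<b}" by auto
    with \<gamma>'(2) have "vector_derivative \<gamma> (at u) = \<gamma>' u" by (simp add: vector_derivative_at)
    moreover have "\<gamma> u \<in> \<Omega>" using im \<open>u \<in> {a<..<b}\<close> by force
    ultimately show "hilbert_finsler \<Omega> (\<gamma> u) (vector_derivative \<gamma> (at u)) =
        gauge_at (\<gamma> u) (- \<gamma>' u) + gauge_at (\<gamma> u) (\<gamma>' u)"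
      by (simp add: hilbert_finsler_eq)
  qed simp
qed

text \<open>In absolute value, the logarithmic derivative of one wall function along the path is at
  most the Finsler speed; it is integrated with either sign.\<close>

lemma hilbert_length_ge:
  assumes \<gamma>: "piecewise_smooth_path \<gamma>" "path_image \<gamma> \<subseteq> \<Omega>" and i: "i \<in> I"
  shows "\<bar>ln (k i \<bullet> pathfinish \<gamma> + c i) - ln (k i \<bullet> pathstart \<gamma> + c i)\<bar> \<le> hilbert_length \<Omega> \<gamma>"
proof -
  define F where "F u = hilbert_finsler \<Omega> (\<gamma> u) (vector_derivative \<gamma> (at u))" for u
  define L where "L u = ln (k i \<bullet> \<gamma> u + c i)" for u
  define L' where "L' u = (k i \<bullet> vector_derivative \<gamma> (at u)) / (k i \<bullet> \<gamma> u + c i)" for u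
  from \<gamma> obtain n \<tau> where n: "\<tau> 0 = 0" "\<tau> n = (1::real)"
    and \<tau>: "\<And>i. i < n \<Longrightarrow> \<tau> i < \<tau> (Suc i)"
    and sm: "\<And>i. i < n \<Longrightarrow> smooth_on_interval (\<tau> i) (\<tau> (Suc i)) \<gamma>"
    by (auto simp: piecewise_smooth_path_def)
  have cont: "continuous_on {0..1} \<gamma>"
    using \<gamma>(1) by (simp add: piecewise_smooth_path_def path_def)
  have mono: "\<tau> i \<le> \<tau> j" if "i \<le> j" "j \<le> n" for i j
    using that(1,2)
  proof (induction j rule: dec_induct)
    case (step m)
    with \<tau>[of m] show ?case by simp
  qed simp
  have in01: "{\<tau> i..\<tau> (Suc i)} \<subseteq> {0..1}" if "i < n" for i
    using mono[of 0 i] mono[of "Suc i" n] that n by auto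
  have img: "\<gamma> u \<in> \<Omega>" if "u \<in> {0..1}" for u
    using \<gamma>(2) that by (auto simp: path_image_def)
  \<comment> \<open>Integrability has to be established here: otherwise the length would take the
    default value 0, which bounds no variation from above.\<close>
  have "F integrable_on {0..\<tau> j}" if "j \<le> n" for j
    using that
  proof (induction j)
    case 0
    then show ?case using integrable_on_refl[of F "0::real"] by (simp add: n)
  next
    case (Suc j)
    have "F integrable_on {\<tau> j..\<tau> (Suc j)}"
      unfolding F_def
    proof (rule finsler_integrable_piece[OF sm])
      show "j < n" using Suc.prems by simp
      then have "{\<tau> j..\<tau> (Suc j)} \<subseteq> {0..1}" by (rule in01)
      then show "continuous_on {\<tau> j..\<tau> (Suc j)} \<gamma>" "\<gamma> ` {\<tau> j..\<tau> (Suc j)} \<subseteq> \<Omega>"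
        using continuous_on_subset[OF cont] img by blast+
    qed
    moreover have "0 \<le> \<tau> j" "\<tau> j \<le> \<tau> (Suc j)" "F integrable_on {0..\<tau> j}"
      using Suc mono[of 0 j] \<tau>[of j] n by simp_all
    ultimately show ?case
      using Henstock_Kurzweil_Integration.integrable_combine by blast
  qed
  from this[of n] have F: "F integrable_on {0..1}" using n by simp
  \<comment> \<open>Off the finite set of break points the path is differentiable, which together
    with continuity is what the fundamental theorem requires below.\<close>
  have cover: "\<exists>j<n. u \<in> {\<tau> j<..<\<tau> (Suc j)}" if u: "u \<in> {0..\<tau> m} - \<tau> ` {..m}" "m \<le> n" for u m
    using u
  proof (induction m)
    case (Suc m)
    have notin: "u \<noteq> \<tau> i" if "i \<le> Suc m" for i
      using Suc.prems(1) that by blast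
    show ?case
    proof (cases "u < \<tau> m")
      case True
      then have "u \<in> {0..\<tau> m} - \<tau> ` {..m}"
        using Suc.prems(1) notin by (simp add: image_iff)
      with Suc.IH Suc.prems(2) show ?thesis by simp
    next
      case False
      with notin[of m] notin[of "Suc m"] Suc.prems(1) have "u \<in> {\<tau> m<..<\<tau> (Suc m)}"
        by simp
      with Suc.prems(2) show ?thesis by (intro exI[of _ m]) simp
    qed
  qed (simp add: n)
  have "continuous_on {0..1} L"
    unfolding L_def
  proof (intro continuous_intros cont ballI)
    fix u :: real assume "u \<in> {0..1}"
    then show "k i \<bullet> \<gamma> u + c i \<noteq> 0" using pos[OF img i] by (metis less_irrefl)
  qed
  moreover have "(L has_vector_derivative L' u) (at u)" if "u \<in> {0<..<1} - \<tau> ` {..n}" for u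
  proof -
    from that have "u \<in> {0..\<tau> n} - \<tau> ` {..n}" by (simp add: n)
    then obtain j where j: "j < n" "u \<in> {\<tau> j<..<\<tau> (Suc j)}" using cover by blast
    obtain \<gamma>' where
      "\<And>u. u \<in> {\<tau> j<..<\<tau> (Suc j)} \<Longrightarrow> (\<gamma> has_vector_derivative \<gamma>' u) (at u)"
      using smooth_on_interval_continuous_derivative[OF sm[OF j(1)]] by blast
    with j have d: "(\<gamma> has_vector_derivative vector_derivative \<gamma> (at u)) (at u)"
      by (metis vector_derivative_at)
    have "((\<lambda>u. k i \<bullet> \<gamma> u + c i) has_vector_derivative k i \<bullet> vector_derivative \<gamma> (at u)) (at u)"
      by (auto intro!: derivative_eq_intros d
            bounded_linear.has_vector_derivative[OF bounded_linear_inner_right])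
    then have "((\<lambda>u. k i \<bullet> \<gamma> u + c i) has_real_derivative k i \<bullet> vector_derivative \<gamma> (at u)) (at u)"
      by (simp add: has_real_derivative_iff_has_vector_derivative)
    then have "((\<lambda>u. ln (k i \<bullet> \<gamma> u + c i)) has_real_derivative
        k i \<bullet> vector_derivative \<gamma> (at u) / (k i \<bullet> \<gamma> u + c i)) (at u)"
      using DERIV_chain2[where f = ln and g = "\<lambda>u. k i \<bullet> \<gamma> u + c i",
          OF DERIV_ln_divide[OF pos[OF img i, of u]]] that
      by (force elim!: DERIV_cong)
    then show ?thesis
      by (simp add: L_def[abs_def] L'_def has_real_derivative_iff_has_vector_derivative)
  qed
  ultimately have L: "(L' has_integral (L 1 - L 0)) {0..1}"
    by (intro fundamental_theorem_of_calculus_interior_strong[of "\<tau> ` {..n}"]) simp_all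
  have le: "\<bar>L' u\<bar> \<le> F u" if "u \<in> {0..1}" for u
    using hilbert_finsler_ge[OF img[OF that] i] pos[OF img[OF that] i]
    by (simp add: F_def L'_def abs_divide)
  have "L 1 - L 0 \<le> integral {0..1} F"
    by (rule has_integral_le[OF L integrable_integral[OF F]]) (use le abs_le_D1 in blast)
  moreover have "- (L 1 - L 0) \<le> integral {0..1} F"
    by (rule has_integral_le[OF has_integral_neg[OF L] integrable_integral[OF F]])
      (use le abs_le_D2 in blast)
  ultimately show ?thesis
    by (simp add: L_def F_def[abs_def] hilbert_length_def pathstart_def pathfinish_def)
qed

lemma hilbert_ge:
  assumes x: "x \<in> \<Omega>" and y: "y \<in> \<Omega>" and i: "i \<in> I"
  shows "\<bar>ln (k i \<bullet> y + c i) - ln (k i \<bullet> x + c i)\<bar> \<le> hilbert \<Omega> x y"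
  unfolding hilbert_def
proof (rule cInf_greatest)
  have "path_image (linepath x y) \<subseteq> \<Omega>"
    using convex_\<Omega> x y by (simp add: convex_contains_segment)
  then show "{hilbert_length \<Omega> \<gamma> |\<gamma>. piecewise_smooth_path \<gamma> \<and> path_image \<gamma> \<subseteq> \<Omega> \<and>
      pathstart \<gamma> = x \<and> pathfinish \<gamma> = y} \<noteq> {}"
    using piecewise_smooth_linepath[of x y] by fastforce
  fix l assume "l \<in> {hilbert_length \<Omega> \<gamma> |\<gamma>. piecewise_smooth_path \<gamma> \<and> path_image \<gamma> \<subseteq> \<Omega> \<and>
      pathstart \<gamma> = x \<and> pathfinish \<gamma> = y}"
  then obtain \<gamma> where "l = hilbert_length \<Omega> \<gamma>" "piecewise_smooth_path \<gamma>" "path_image \<gamma> \<subseteq> \<Omega>"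
    "pathstart \<gamma> = x" "pathfinish \<gamma> = y" by (elim CollectE exE conjE) (rule that)
  with hilbert_length_ge[of \<gamma>, OF _ _ i]
  show "\<bar>ln (k i \<bullet> y + c i) - ln (k i \<bullet> x + c i)\<bar> \<le> l" by simp
qed

end

section \<open>Chains of lightlike segments\<close>

lemma affine_nonzero_imp:
  fixes a b :: real
  assumes "\<And>s. s \<in> {-1<..<1} \<Longrightarrow> a * s + b \<noteq> 0"
  shows "\<bar>a\<bar> \<le> \<bar>b\<bar>"
proof (rule ccontr)
  assume "\<not> \<bar>a\<bar> \<le> \<bar>b\<bar>"
  then have "- b / a \<in> {-1<..<1}" "a \<noteq> 0"
    by (auto simp: field_simps abs_if split: if_splits)
  with assms[of "- b / a"] show False by simp
qed

text \<open>The differences of the sides of the last two inequalities are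
  \<open>(t - s) * (a + b)\<close> and \<open>(t - s) * (b - a)\<close>. In logarithmic terms, an
  affine function positive on the interval varies at least as much as \<open>1 - s\<close> and at
  most as much as \<open>1 + s\<close>, the extreme cases that vanish at an end.\<close>

lemma affine_quotient_bounds:
  fixes a b s t :: real
  assumes ab: "\<bar>a\<bar> \<le> b" "0 < b" and st: "-1 < s" "s \<le> t" "t < 1"
  shows "0 < a * s + b" "0 < a * t + b"
    "(1 - t) * (a * s + b) \<le> (1 - s) * (a * t + b)"
    "(1 + s) * (a * t + b) \<le> (1 + t) * (a * s + b)"
proof -
  have pos: "0 < a * r + b" if "-1 < r" "r < 1" for r
  proof -
    have "\<bar>a * r\<bar> \<le> b * \<bar>r\<bar>" using ab by (simp add: abs_mult mult_right_mono)
    also have "\<dots> < b" using ab that by simp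
    finally show ?thesis by linarith
  qed
  show "0 < a * s + b" "0 < a * t + b" using pos st by auto
  have "0 \<le> (t - s) * (a + b)" "0 \<le> (t - s) * (b - a)"
    using ab st by (auto intro!: mult_nonneg_nonneg)
  then show "(1 - t) * (a * s + b) \<le> (1 - s) * (a * t + b)"
    "(1 + s) * (a * t + b) \<le> (1 + t) * (a * s + b)"
    by (simp_all add: algebra_simps)
qed

lemma rho_I_commute: "rho_I s t = rho_I t s"
proof -
  have "((s - 1) * (t + 1)) / ((s + 1) * (t - 1)) = inverse (((t - 1) * (s + 1)) / ((t + 1) * (s - 1)))"
    by (simp add: ac_simps)
  then show ?thesis unfolding rho_I_def by (metis abs_minus_cancel ln_inverse)
qed

lemma rho_I_eq:
  assumes "-1 < s" "s \<le> t" "t < 1"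
  shows "rho_I s t = ln (((1 - s) * (1 + t)) / ((1 + s) * (1 - t)))"
proof -
  have "((s - 1) * (t + 1)) / ((s + 1) * (t - 1)) = ((1 - s) * (1 + t)) / ((1 + s) * (1 - t))"
    using minus_divide_divide[of "(s - 1) * (t + 1)" "(s + 1) * (t - 1)"]
    by (simp add: algebra_simps)
  moreover have "1 \<le> ((1 - s) * (1 + t)) / ((1 + s) * (1 - t))"
    using assms by (simp add: le_divide_eq) (simp add: algebra_simps)
  ultimately show ?thesis by (simp add: rho_I_def)
qed

text \<open>Numerator and denominator have no zero on the interval, so the logarithmic variation of
  each lies between those of \<open>1 - s\<close> and \<open>1 + s\<close>. The variation of the
  quotient is a difference of two numbers of that range, and \<open>rho_I\<close> is the length of
  the range.\<close>

lemma rho_I_homography: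
  fixes a b c d s t :: real
  defines "f \<equiv> \<lambda>s. (a * s + b) / (c * s + d)"
  assumes s: "s \<in> {-1<..<1}" and t: "t \<in> {-1<..<1}"
    and nz: "\<And>s. s \<in> {-1<..<1} \<Longrightarrow> c * s + d \<noteq> 0"
    and pos: "\<And>s. s \<in> {-1<..<1} \<Longrightarrow> 0 < f s"
  shows "\<bar>ln (f t) - ln (f s)\<bar> \<le> rho_I s t"
proof -
  have main: "\<bar>ln ((a * t + b) / (c * t + d)) - ln ((a * s + b) / (c * s + d))\<bar> \<le> rho_I s t"
    if st: "-1 < s" "s \<le> t" "t < 1" and ab: "\<bar>a\<bar> \<le> b" "0 < b" and cd: "\<bar>c\<bar> \<le> d" "0 < d"
    for a b c d s t :: real
  proof -
    note A = affine_quotient_bounds[OF ab st] and C = affine_quotient_bounds[OF cd st]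
    have p: "0 < 1 - s" "0 < 1 + s" "0 < 1 - t" "0 < 1 + t" using st by auto
    have l: "ln (1 - t) + ln (a * s + b) \<le> ln (1 - s) + ln (a * t + b)"
      "ln (1 + s) + ln (a * t + b) \<le> ln (1 + t) + ln (a * s + b)"
      "ln (1 - t) + ln (c * s + d) \<le> ln (1 - s) + ln (c * t + d)"
      "ln (1 + s) + ln (c * t + d) \<le> ln (1 + t) + ln (c * s + d)"
      using A C p by (simp_all add: ln_mult_pos[symmetric])
    have "rho_I s t = ln (1 - s) + ln (1 + t) - (ln (1 + s) + ln (1 - t))"
      using st p by (simp add: rho_I_eq ln_div ln_mult_pos)
    with l A(1,2) C(1,2) show ?thesis by (simp add: ln_div)
  qed
  have nz': "a * s + b \<noteq> 0" if "s \<in> {-1<..<1}" for s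
    using pos[OF that] by (auto simp: f_def)
  have ad: "\<bar>a\<bar> \<le> \<bar>b\<bar>" "\<bar>c\<bar> \<le> \<bar>d\<bar>"
    using nz nz' by (auto intro!: affine_nonzero_imp)
  \<comment> \<open>The value at 0 shows that the constant terms have the same sign; if both are
    negative, all four coefficients are negated.\<close>
  have "0 < b / d" using pos[of 0] by (simp add: f_def)
  then consider "0 < b" "0 < d" | "b < 0" "d < 0" by (auto simp: zero_less_divide_iff)
  then have main': "\<bar>ln (f t) - ln (f s)\<bar> \<le> rho_I s t" if st: "-1 < s" "s \<le> t" "t < 1" for s t
  proof cases
    case 1
    with main[OF st, of a b c d] ad show ?thesis by (simp add: f_def)
  next
    case 2
    have "f r = (- a * r + - b) / (- c * r + - d)" for r
      using minus_divide_divide[of "a * r + b" "c * r + d"] by (simp add: f_def)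
    with 2 main[OF st, of "- a" "- b" "- c" "- d"] ad show ?thesis by simp
  qed
  show ?thesis
    using main'[of s t] main'[of t s] s t rho_I_commute[of s t]
    by (cases "s \<le> t") (auto simp: abs_minus_commute)
qed

section \<open>Chains in inductive form\<close>

inductive light_step :: "mink set \<Rightarrow> mink \<Rightarrow> mink \<Rightarrow> real \<Rightarrow> bool" for \<Omega> where
  geodesic: "proj_lightlike_geodesic \<Omega> \<gamma> \<Longrightarrow> s \<in> {-1<..<1} \<Longrightarrow> t \<in> {-1<..<1} \<Longrightarrow>
    light_step \<Omega> (\<gamma> s) (\<gamma> t) (rho_I s t)"

text \<open>The indexed families of \<open>markowitz_chain\<close> with the cost as an argument:
  estimates become inductions on the last step, and reversing or joining chains involves no
  renumbering.\<close>

inductive light_chain :: "mink set \<Rightarrow> mink \<Rightarrow> mink \<Rightarrow> real \<Rightarrow> bool" for \<Omega> where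
  single: "light_step \<Omega> x y r \<Longrightarrow> light_chain \<Omega> x y r"
| snoc: "light_chain \<Omega> x y r \<Longrightarrow> light_step \<Omega> y z r' \<Longrightarrow> light_chain \<Omega> x z (r + r')"

lemma light_chain_imp_markowitz_chain:
  assumes "light_chain \<Omega> x y r"
  shows "\<exists>m \<gamma> s t. markowitz_chain \<Omega> x y m \<gamma> s t \<and> r = (\<Sum>k=1..m. rho_I (s k) (t k))"
  using assms
proof induction
  case (single x y r)
  then obtain \<gamma> s t where "x = \<gamma> s" "y = \<gamma> t" "r = rho_I s t"
    "proj_lightlike_geodesic \<Omega> \<gamma>" "s \<in> {-1<..<1}" "t \<in> {-1<..<1}"
    by (rule light_step.cases)
  then show ?case
    by (intro exI[of _ 1] exI[of _ "\<lambda>_. \<gamma>"] exI[of _ "\<lambda>_. s"] exI[of _ "\<lambda>_. t"])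
      (simp add: markowitz_chain_def)
next
  case (snoc x y r z r')
  then obtain m \<gamma> s t where c: "markowitz_chain \<Omega> x y m \<gamma> s t"
    and r: "r = (\<Sum>k=1..m. rho_I (s k) (t k))" by blast
  from snoc.hyps(2) obtain \<gamma>' s' t' where g: "y = \<gamma>' s'" "z = \<gamma>' t'" "r' = rho_I s' t'"
    "proj_lightlike_geodesic \<Omega> \<gamma>'" "s' \<in> {-1<..<1}" "t' \<in> {-1<..<1}"
    by (rule light_step.cases)
  let ?\<gamma> = "\<gamma>(Suc m := \<gamma>')" and ?s = "s(Suc m := s')" and ?t = "t(Suc m := t')"
  have "markowitz_chain \<Omega> x z (Suc m) ?\<gamma> ?s ?t"
    using c g unfolding markowitz_chain_def
    by (auto simp: le_Suc_eq less_Suc_eq)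
  moreover have "r + r' = (\<Sum>k=1..Suc m. rho_I (?s k) (?t k))"
    by (simp add: r g)
  ultimately show ?case by blast
qed

lemma markowitz_chain_imp_light_chain:
  assumes "markowitz_chain \<Omega> x y m \<gamma> s t"
  shows "light_chain \<Omega> x y (\<Sum>k=1..m. rho_I (s k) (t k))"
proof -
  have "j \<le> m \<Longrightarrow> light_chain \<Omega> x (\<gamma> j (t j)) (\<Sum>k=1..j. rho_I (s k) (t k))" if "1 \<le> j" for j
    using that
  proof (induction j rule: dec_induct)
    case base
    have "light_step \<Omega> x (\<gamma> 1 (t 1)) (rho_I (s 1) (t 1))"
      using assms light_step.geodesic[of \<Omega> "\<gamma> 1" "s 1" "t 1"] by (simp add: markowitz_chain_def)
    then show ?case by (simp add: light_chain.single)
  next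
    case (step j)
    have "light_step \<Omega> (\<gamma> j (t j)) (\<gamma> (Suc j) (t (Suc j))) (rho_I (s (Suc j)) (t (Suc j)))"
      using assms step.hyps step.prems light_step.geodesic[of \<Omega> "\<gamma> (Suc j)" "s (Suc j)" "t (Suc j)"]
      by (simp add: markowitz_chain_def)
    with step have "light_chain \<Omega> x (\<gamma> (Suc j) (t (Suc j)))
        ((\<Sum>k=1..j. rho_I (s k) (t k)) + rho_I (s (Suc j)) (t (Suc j)))"
      by (intro light_chain.snoc) auto
    then show ?case by simp
  qed
  from this[of m] assms show ?thesis by (simp add: markowitz_chain_def)
qed

lemma markowitz_eq: "markowitz \<Omega> x y = Inf {r. light_chain \<Omega> x y r}"
proof -
  have "{\<Sum>k=1..m. rho_I (s k) (t k) | m \<gamma> s t. markowitz_chain \<Omega> x y m \<gamma> s t} =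
      {r. light_chain \<Omega> x y r}"
  proof (intro set_eqI iffI)
    fix r assume "r \<in> {\<Sum>k=1..m. rho_I (s k) (t k) | m \<gamma> s t. markowitz_chain \<Omega> x y m \<gamma> s t}"
    then show "r \<in> {r. light_chain \<Omega> x y r}"
      by (elim CollectE exE conjE) (simp only: mem_Collect_eq markowitz_chain_imp_light_chain)
  next
    fix r assume "r \<in> {r. light_chain \<Omega> x y r}"
    then show "r \<in> {\<Sum>k=1..m. rho_I (s k) (t k) | m \<gamma> s t. markowitz_chain \<Omega> x y m \<gamma> s t}"
      using light_chain_imp_markowitz_chain[of \<Omega> x y r] by (simp add: conj_commute)
  qed
  then show ?thesis by (simp add: markowitz_def)
qed

lemma light_step_nonneg: "light_step \<Omega> x y r \<Longrightarrow> 0 \<le> r"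
  by (induction rule: light_step.induct) (simp add: rho_I_def)

lemma light_chain_nonneg: "light_chain \<Omega> x y r \<Longrightarrow> 0 \<le> r"
  by (induction rule: light_chain.induct) (auto dest: light_step_nonneg)

lemma markowitz_le: "light_chain \<Omega> x y r \<Longrightarrow> markowitz \<Omega> x y \<le> r"
  unfolding markowitz_eq by (intro cInf_lower bdd_belowI[of _ 0]) (auto dest: light_chain_nonneg)

lemma light_step_commute: "light_step \<Omega> x y r \<Longrightarrow> light_step \<Omega> y x r"
  by (induction rule: light_step.induct) (subst rho_I_commute, rule light_step.geodesic)

lemma light_chain_trans:
  assumes "light_chain \<Omega> y z r'" "light_chain \<Omega> x y r"
  shows "light_chain \<Omega> x z (r + r')"
  using assms
proof induction
  case (single y z r')
  then show ?case by (intro light_chain.snoc)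
next
  case (snoc y z r' w r'')
  have "light_chain \<Omega> x w ((r + r') + r'')"
    using snoc.IH[OF snoc.prems] snoc.hyps(2) by (rule light_chain.snoc)
  then show ?case by (simp only: add.assoc)
qed

lemma light_chain_commute: "light_chain \<Omega> x y r \<Longrightarrow> light_chain \<Omega> y x r"
proof (induction rule: light_chain.induct)
  case (single x y r)
  then show ?case by (rule light_chain.single[OF light_step_commute])
next
  case (snoc x y r z r')
  have "light_chain \<Omega> z y r'" by (rule light_chain.single[OF light_step_commute[OF snoc.hyps(2)]])
  from light_chain_trans[OF snoc.IH this] show ?case by (simp add: add.commute)
qed

lemma proj_lightlike_geodesic_mono:
  "proj_lightlike_geodesic \<Omega> \<gamma> \<Longrightarrow> \<Omega> \<subseteq> \<Omega>' \<Longrightarrow> proj_lightlike_geodesic \<Omega>' \<gamma>"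
  unfolding proj_lightlike_geodesic_def by (elim conjE, rule conjI, assumption, rule subset_trans)

lemma light_step_mono: "light_step \<Omega> x y r \<Longrightarrow> \<Omega> \<subseteq> \<Omega>' \<Longrightarrow> light_step \<Omega>' x y r"
  by (induction rule: light_step.induct)
    (rule light_step.geodesic[OF proj_lightlike_geodesic_mono])

lemma light_chain_mono:
  assumes "light_chain \<Omega> x y r" "\<Omega> \<subseteq> \<Omega>'"
  shows "light_chain \<Omega>' x y r"
  using assms
proof induction
  case (single x y r)
  then show ?case by (rule light_chain.single[OF light_step_mono])
next
  case (snoc x y r z r')
  from light_chain.snoc[OF snoc.IH[OF snoc.prems] light_step_mono[OF snoc.hyps(2) snoc.prems]]
  show ?case .
qed

lemma light_step_in: "light_step \<Omega> x y r \<Longrightarrow> x \<in> \<Omega> \<and> y \<in> \<Omega>"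
  by (induction rule: light_step.induct)
    (simp add: proj_lightlike_geodesic_def image_subset_iff)

section \<open>Lower bounds for the cost of chains\<close>

lemma light_step_elim:
  assumes "light_step \<Omega> x y r"
  obtains z v a b c d s t where "lightlike v" "s \<in> {-1<..<1}" "t \<in> {-1<..<1}" "r = rho_I s t"
    "\<And>s. s \<in> {-1<..<1} \<Longrightarrow> c * s + d \<noteq> 0"
    "\<And>s. s \<in> {-1<..<1} \<Longrightarrow> z + ((a * s + b) / (c * s + d)) *\<^sub>R v \<in> \<Omega>"
    "x = z + ((a * s + b) / (c * s + d)) *\<^sub>R v" "y = z + ((a * t + b) / (c * t + d)) *\<^sub>R v"
proof -
  from assms obtain \<gamma> s t where xy: "x = \<gamma> s" "y = \<gamma> t" and r: "r = rho_I s t"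
    and \<gamma>: "proj_lightlike_geodesic \<Omega> \<gamma>" and st: "s \<in> {-1<..<1}" "t \<in> {-1<..<1}"
    by (rule light_step.cases)
  from \<gamma> obtain z v a b c d where v: "lightlike v"
    and all: "\<forall>s\<in>{-1<..<1}. c * s + d \<noteq> 0 \<and> \<gamma> s = z + ((a * s + b) / (c * s + d)) *\<^sub>R v"
    and im: "\<gamma> ` {-1<..<1} \<subseteq> \<Omega>"
    unfolding proj_lightlike_geodesic_def by (elim exE conjE) (rule that)
  show ?thesis
  proof (rule that[OF v st r])
    show "c * s + d \<noteq> 0" if "s \<in> {-1<..<1}" for s using all that by simp
    show "z + ((a * s + b) / (c * s + d)) *\<^sub>R v \<in> \<Omega>" if "s \<in> {-1<..<1}" for s
      using all im that by (metis image_subset_iff)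
  qed (simp_all only: xy all[rule_format, OF st(1)] all[rule_format, OF st(2)])
qed

lemma light_step_direction:
  assumes "light_step \<Omega> x y r"
  obtains v l where "lightlike v" "y = x + l *\<^sub>R v"
proof -
  from assms obtain z v a b c d s t where "lightlike v"
    "x = z + ((a * s + b) / (c * s + d)) *\<^sub>R v" "y = z + ((a * t + b) / (c * t + d)) *\<^sub>R v"
    by (rule light_step_elim)
  then show ?thesis
    using that[of v "(a * t + b) / (c * t + d) - (a * s + b) / (c * s + d)"]
    by (simp add: scaleR_left_diff_distrib)
qed

text \<open>Composing the affine function with the geodesic gives a homography with the denominator
  of the parametrization; it is positive because the whole geodesic stays in
  \<open>\<Omega>\<close>.\<close>

lemma light_step_ge:
  assumes step: "light_step \<Omega> x y r" and sub: "\<And>z. z \<in> \<Omega> \<Longrightarrow> 0 < k \<bullet> z + c"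
  shows "\<bar>ln (k \<bullet> y + c) - ln (k \<bullet> x + c)\<bar> \<le> r"
proof -
  from step obtain z v a b c' d s t where "lightlike v"
    and st: "s \<in> {-1<..<1}" "t \<in> {-1<..<1}" "r = rho_I s t"
    and nz: "\<And>s. s \<in> {-1<..<1} \<Longrightarrow> c' * s + d \<noteq> 0"
    and im: "\<And>s. s \<in> {-1<..<1} \<Longrightarrow> z + ((a * s + b) / (c' * s + d)) *\<^sub>R v \<in> \<Omega>"
    and xy: "x = z + ((a * s + b) / (c' * s + d)) *\<^sub>R v" "y = z + ((a * t + b) / (c' * t + d)) *\<^sub>R v"
    by (rule light_step_elim) (rule that)
  define A B where "A = (k \<bullet> z + c) * c' + (k \<bullet> v) * a" and "B = (k \<bullet> z + c) * d + (k \<bullet> v) * b"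
  have eq: "k \<bullet> (z + ((a * s + b) / (c' * s + d)) *\<^sub>R v) + c = (A * s + B) / (c' * s + d)"
    if "s \<in> {-1<..<1}" for s
    using nz[OF that] by (simp add: A_def B_def inner_add_right field_simps)
  have "0 < (A * s + B) / (c' * s + d)" if "s \<in> {-1<..<1}" for s
    using sub[OF im[OF that]] eq[OF that] by simp
  from rho_I_homography[OF st(1,2) nz this] show ?thesis
    unfolding xy eq[OF st(1)] eq[OF st(2)] st(3) by simp
qed

lemma light_chain_ge:
  assumes "light_chain \<Omega> x y r" and sub: "\<And>z. z \<in> \<Omega> \<Longrightarrow> 0 < k \<bullet> z + c"
  shows "\<bar>ln (k \<bullet> y + c) - ln (k \<bullet> x + c)\<bar> \<le> r"
  using assms(1)
proof induction
  case (snoc x y r z r')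
  from light_step_ge[OF snoc.hyps(2) sub] snoc.IH show ?case by linarith
qed (rule light_step_ge[OF _ sub])

text \<open>Schwarz's lemma for the half plane bounds the relative change of the height above the
  boundary; as lightlike directions are transverse to it, it also bounds the displacement.\<close>

lemma light_chain_displacement:
  assumes "light_chain \<Omega> x y r" and sub: "\<And>z. z \<in> \<Omega> \<Longrightarrow> 0 < k \<bullet> z + c"
    and "0 \<le> \<kappa>" and \<kappa>: "\<And>v. lightlike v \<Longrightarrow> \<kappa> * norm v \<le> \<bar>k \<bullet> v\<bar>"
  shows "\<kappa> * norm (y - x) \<le> (k \<bullet> x + c) * (exp r - 1)"
proof -
  \<comment> \<open>The growth of the height is carried along, since each step is estimated relative
    to the height at which it starts.\<close>
  have step: "\<kappa> * norm (y - x) \<le> (k \<bullet> x + c) * (exp r - 1) \<and> k \<bullet> y + c \<le> (k \<bullet> x + c) * exp r"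
    if s: "light_step \<Omega> x y r" for x y r
  proof -
    from light_step_direction[OF s] obtain v l where v: "lightlike v" "y = x + l *\<^sub>R v" by blast
    define X Y where "X = k \<bullet> x + c" and "Y = k \<bullet> y + c"
    have pos: "0 < X" "0 < Y" using light_step_in[OF s] sub by (auto simp: X_def Y_def)
    have le: "\<bar>ln Y - ln X\<bar> \<le> r" using light_step_ge[OF s sub] by (simp add: X_def Y_def)
    then have "ln Y \<le> ln (X * exp r)" "ln (X * exp (- r)) \<le> ln Y"
      using pos by (simp_all add: ln_mult_pos)
    then have Y: "Y \<le> X * exp r" "X * exp (- r) \<le> Y"
      using pos by simp_all
    \<comment> \<open>Hence a relative loss of height, at most \<open>1 - exp (- r)\<close>, never
      exceeds the bound \<open>exp r - 1\<close> for a gain.\<close>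
    have "2 \<le> exp r + exp (- r)"
      using exp_ge_add_one_self[of r] exp_ge_add_one_self[of "- r"] by linarith
    then have "X * 2 \<le> X * (exp r + exp (- r))" using pos by (intro mult_left_mono) auto
    with Y have "\<bar>Y - X\<bar> \<le> X * (exp r - 1)" by (simp add: algebra_simps)
    moreover have "Y - X = l * (k \<bullet> v)" by (simp add: X_def Y_def v inner_add_right)
    then have "\<bar>Y - X\<bar> = \<bar>l\<bar> * \<bar>k \<bullet> v\<bar>" by (simp add: abs_mult)
    moreover have "\<bar>l\<bar> * (\<kappa> * norm v) \<le> \<bar>l\<bar> * \<bar>k \<bullet> v\<bar>" using \<kappa>[OF v(1)] by (intro mult_left_mono) auto
    ultimately show ?thesis using Y by (simp add: v X_def Y_def ac_simps)
  qed
  from assms(1) have "\<kappa> * norm (y - x) \<le> (k \<bullet> x + c) * (exp r - 1) \<and> k \<bullet> y + c \<le> (k \<bullet> x + c) * exp r"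
  proof induction
    case (snoc x y r z r')
    let ?X = "k \<bullet> x + c" and ?Y = "k \<bullet> y + c"
    note st = step[OF snoc.hyps(2)]
    have "0 \<le> r'" using snoc.hyps(2) by (rule light_step_nonneg)
    have "\<kappa> * norm (z - x) \<le> \<kappa> * norm (y - x) + \<kappa> * norm (z - y)"
      using \<open>0 \<le> \<kappa>\<close> norm_triangle_ineq[of "y - x" "z - y"]
      by (simp add: distrib_left[symmetric] mult_left_mono)
    also have "\<dots> \<le> ?X * (exp r - 1) + ?Y * (exp r' - 1)"
      using st snoc.IH by linarith
    also have "\<dots> \<le> ?X * (exp r - 1) + ?X * exp r * (exp r' - 1)"
      using snoc.IH \<open>0 \<le> r'\<close> by (intro add_left_mono mult_right_mono) auto
    finally have "\<kappa> * norm (z - x) \<le> ?X * (exp (r + r') - 1)"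
      by (simp add: algebra_simps exp_add)
    moreover have "?Y * exp r' \<le> ?X * exp r * exp r'"
      using snoc.IH by (intro mult_right_mono) auto
    with st have "k \<bullet> z + c \<le> ?X * exp r * exp r'" by linarith
    then have "k \<bullet> z + c \<le> ?X * exp (r + r')" by (simp only: exp_add mult.assoc)
    ultimately show ?case by blast
  qed (use step in blast)
  then show ?thesis by blast
qed

text \<open>One form for bounded intervals and both kinds of half line, as the set where
  \<open>A * a + B\<close> and \<open>C * a + D\<close> are positive: the first function bounds on
  the left, the second on the right, and one of them may be a positive constant. The positive
  determinant excludes the empty set and the whole line.\<close>

definition ivl_coeffs :: "real \<Rightarrow> real \<Rightarrow> real \<Rightarrow> real \<Rightarrow> bool" where
  "ivl_coeffs A B C D \<longleftrightarrow> 0 \<le> A \<and> C \<le> 0 \<and> 0 < A * D - B * C"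

text \<open>Parametrizing the full lightlike segment makes Schwarz's lemma sharp: the cost is
  exactly the variation of the logarithm of the quotient of the two bounding functions.\<close>

lemma light_step_ivl:
  assumes ivl: "ivl_coeffs A B C D" and v: "lightlike v"
    and sub: "\<And>a. 0 < A * a + B \<Longrightarrow> 0 < C * a + D \<Longrightarrow> z + a *\<^sub>R v \<in> \<Omega>"
    and a: "0 < A * a + B" "0 < C * a + D" and b: "0 < A * b + B" "0 < C * b + D"
  shows "light_step \<Omega> (z + a *\<^sub>R v) (z + b *\<^sub>R v)
    \<bar>(ln (A * b + B) - ln (C * b + D)) - (ln (A * a + B) - ln (C * a + D))\<bar>"
proof -
  define \<Delta> where "\<Delta> = A * D - B * C"
  \<comment> \<open>\<open>h\<close> solves
    \<open>(A * a + B) * (1 - s) = (C * a + D) * (1 + s)\<close> for \<open>a\<close>, so that the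
    ends of the parameter interval go to the ends of the segment; \<open>\<sigma>\<close> solves the
    same equation for \<open>s\<close>.\<close>
  define h where "h s = ((D + B) * s + (D - B)) / (- (A + C) * s + (A - C))" for s
  define \<sigma> where "\<sigma> a = ((A * a + B) - (C * a + D)) / ((A * a + B) + (C * a + D))" for a
  have \<Delta>: "0 < \<Delta>" "0 \<le> A" "C \<le> 0" using ivl by (auto simp: ivl_coeffs_def \<Delta>_def)
  then have AC: "A \<noteq> 0 \<or> C \<noteq> 0" by (auto simp: \<Delta>_def)
  have den: "0 < - (A + C) * s + (A - C)" if "s \<in> {-1<..<1}" for s
  proof -
    have "0 \<le> A * (1 - s)" "0 \<le> - C * (1 + s)" using that \<Delta> by (auto intro!: mult_nonneg_nonneg mult_nonpos_nonneg)
    moreover have "A * (1 - s) \<noteq> 0 \<or> - C * (1 + s) \<noteq> 0" using AC that by auto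
    ultimately have "0 < A * (1 - s) + - C * (1 + s)" by linarith
    then show ?thesis by (simp add: algebra_simps)
  qed
  have h1: "A * h s + B = \<Delta> * (1 + s) / (- (A + C) * s + (A - C))"
    and h2: "C * h s + D = \<Delta> * (1 - s) / (- (A + C) * s + (A - C))" if "s \<in> {-1<..<1}" for s
    using den[OF that] by (auto simp: h_def \<Delta>_def field_simps)
  have \<sigma>_in: "\<sigma> a \<in> {-1<..<1}" and h\<sigma>: "h (\<sigma> a) = a" if a: "0 < A * a + B" "0 < C * a + D" for a
  proof -
    let ?X = "A * a + B" and ?Y = "C * a + D"
    have s: "?X + ?Y > 0" using a by simp
    then show "\<sigma> a \<in> {-1<..<1}" using a by (simp add: \<sigma>_def field_simps)
    have n: "(D + B) * \<sigma> a + (D - B) = 2 * \<Delta> * a / (?X + ?Y)"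
      "- (A + C) * \<sigma> a + (A - C) = 2 * \<Delta> / (?X + ?Y)"
      using s by (simp_all add: \<sigma>_def \<Delta>_def divide_simps) (simp_all add: algebra_simps)
    then show "h (\<sigma> a) = a" unfolding h_def n using s \<Delta> by simp
  qed
  define \<gamma> where "\<gamma> s = z + h s *\<^sub>R v" for s
  have "proj_lightlike_geodesic \<Omega> \<gamma>"
    unfolding proj_lightlike_geodesic_def
  proof (intro conjI exI ballI)
    show "lightlike v" by fact
    show "(D + B) * (A - C) - (D - B) * - (A + C) \<noteq> 0"
      using \<Delta> by (simp add: \<Delta>_def algebra_simps)
    show "- (A + C) * s + (A - C) \<noteq> 0" if "s \<in> {-1<..<1}" for s using den[OF that] by simp
    show "\<gamma> s = z + (((D + B) * s + (D - B)) / (- (A + C) * s + (A - C))) *\<^sub>R v" for s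
      by (simp add: \<gamma>_def h_def)
    show "\<gamma> ` {-1<..<1} \<subseteq> \<Omega>"
    proof (clarsimp simp: \<gamma>_def simp del: greaterThanLessThan_iff)
      fix s :: real assume s: "s \<in> {-1<..<1}"
      show "z + h s *\<^sub>R v \<in> \<Omega>"
        by (rule sub) (use s den[OF s] \<Delta> in \<open>auto simp: h1[OF s] h2[OF s] simp del: minus_add_distrib\<close>)
    qed
  qed
  moreover have "rho_I (\<sigma> a) (\<sigma> b) =
    \<bar>(ln (A * b + B) - ln (C * b + D)) - (ln (A * a + B) - ln (C * a + D))\<bar>"
  proof -
    have \<sigma>: "\<sigma> a - 1 = - (2 * (C * a + D)) / ((A * a + B) + (C * a + D))"
      "\<sigma> a + 1 = 2 * (A * a + B) / ((A * a + B) + (C * a + D))"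
      if "0 < A * a + B" "0 < C * a + D" for a
      using that by (simp_all add: \<sigma>_def field_simps)
    have "((\<sigma> a - 1) * (\<sigma> b + 1)) / ((\<sigma> a + 1) * (\<sigma> b - 1)) =
        ((C * a + D) * (A * b + B)) / ((A * a + B) * (C * b + D))"
    proof -
      define X Y X' Y' where "X = A * a + B" "Y = C * a + D" "X' = A * b + B" "Y' = C * b + D"
      then have "0 < X" "0 < Y" "0 < X'" "0 < Y'" using a b by auto
      then show ?thesis
        unfolding \<sigma>[OF a] \<sigma>[OF b] X_Y_X'_Y'_def[symmetric] by (simp add: divide_simps)
    qed
    then show ?thesis using a b by (simp add: rho_I_def ln_div ln_mult_pos)
  qed
  ultimately show ?thesis
    using light_step.geodesic[of \<Omega> \<gamma> "\<sigma> a" "\<sigma> b"] \<sigma>_in[OF a] \<sigma>_in[OF b] h\<sigma>[OF a] h\<sigma>[OF b]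
    by (simp add: \<gamma>_def)
qed

section \<open>Null boxes\<close>

definition ucoord :: "mink \<Rightarrow> real" where "ucoord x = fst x + snd x"
definition wcoord :: "mink \<Rightarrow> real" where "wcoord x = fst x - snd x"
definition null_point :: "real \<Rightarrow> real \<Rightarrow> mink" where "null_point a b = ((a + b) / 2, (a - b) / 2)"
definition null_box :: "real set \<Rightarrow> real set \<Rightarrow> mink set" where
  "null_box P Q = {x. ucoord x \<in> P \<and> wcoord x \<in> Q}"

lemma ucoord_null_point [simp]: "ucoord (null_point a b) = a"
  and wcoord_null_point [simp]: "wcoord (null_point a b) = b"
  by (simp_all add: ucoord_def wcoord_def null_point_def field_simps)

lemma null_point_coords [simp]: "null_point (ucoord x) (wcoord x) = x"
  by (simp add: ucoord_def wcoord_def null_point_def)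

lemma null_coords_eqI: "ucoord x = ucoord y \<Longrightarrow> wcoord x = wcoord y \<Longrightarrow> x = y"
  by (metis null_point_coords)

lemma null_point_in_box [simp]: "null_point a b \<in> null_box P Q \<longleftrightarrow> a \<in> P \<and> b \<in> Q"
  by (simp add: null_box_def)

lemma mform_null: "mform x x = - (ucoord x * wcoord x)"
  by (simp add: mform_def ucoord_def wcoord_def algebra_simps)

lemma linear_ucoord: "linear ucoord" and linear_wcoord: "linear wcoord"
  by (auto intro!: linearI simp: ucoord_def wcoord_def algebra_simps)

lemma lightlike_iff: "lightlike v \<longleftrightarrow> v \<noteq> 0 \<and> (ucoord v = 0 \<or> wcoord v = 0)"
  by (simp add: lightlike_def mform_null)

lemma null_box_polyhedron:
  "open_polyhedron {..<4} (\<lambda>i. [(A, A), (C, C), (A', - A'), (C', - C')] ! i) (\<lambda>i. [B, D, B', D'] ! i)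
     (null_box {a. 0 < A * a + B \<and> 0 < C * a + D} {a. 0 < A' * a + B' \<and> 0 < C' * a + D'})"
proof
  have *: "(\<forall>i\<in>{..<4}. R i) \<longleftrightarrow> R 0 \<and> R 1 \<and> R 2 \<and> R 3" for R :: "nat \<Rightarrow> bool"
    by (auto simp: numeral_eq_Suc less_Suc_eq)
  show "null_box {a. 0 < A * a + B \<and> 0 < C * a + D} {a. 0 < A' * a + B' \<and> 0 < C' * a + D'} =
      {x. \<forall>i\<in>{..<4}. 0 < ([(A, A), (C, C), (A', - A'), (C', - C')] ! i) \<bullet> x + [B, D, B', D'] ! i}"
    unfolding * by (auto simp: null_box_def ucoord_def wcoord_def inner_prod_def algebra_simps)
qed simp

text \<open>Everything is compared with \<open>S\<close>, the sum of the logarithmic variations of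
  the four wall functions. Both distances are at most \<open>S\<close>, and each single variation is
  at most either distance; the factor 4 is the number of walls.\<close>

lemma
  fixes A B C D A' B' C' D' :: real and x y :: mink
  assumes ivl: "ivl_coeffs A B C D" "ivl_coeffs A' B' C' D'"
  defines "\<Omega> \<equiv> null_box {a. 0 < A * a + B \<and> 0 < C * a + D} {a. 0 < A' * a + B' \<and> 0 < C' * a + D'}"
  assumes x: "x \<in> \<Omega>" and y: "y \<in> \<Omega>"
  shows null_box_chain: "\<exists>r. light_chain \<Omega> x y r"
    and markowitz_le_hilbert_null_box: "markowitz \<Omega> x y \<le> 4 * hilbert \<Omega> x y"
    and hilbert_le_markowitz_null_box: "hilbert \<Omega> x y \<le> 4 * markowitz \<Omega> x y"
proof -
  let ?u = ucoord and ?w = wcoord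
  define d where "d A B a b = \<bar>ln (A * b + B) - ln (A * a + B)\<bar>" for A B a b :: real
  define S where "S = d A B (?u x) (?u y) + d C D (?u x) (?u y) +
    d A' B' (?w x) (?w y) + d C' D' (?w x) (?w y)"
  have coords: "0 < A * ?u z + B" "0 < C * ?u z + D" "0 < A' * ?w z + B'" "0 < C' * ?w z + D'"
    if "z \<in> \<Omega>" for z
    using that by (auto simp: \<Omega>_def null_box_def)
  have l: "lightlike (1/2, 1/2)" "lightlike (1/2, - 1/2)"
    by (auto simp: lightlike_def mform_def prod_eq_iff)
  have np: "null_point 0 b + a *\<^sub>R (1/2, 1/2) = null_point a b"
    "null_point a 0 + b *\<^sub>R (1/2, - 1/2) = null_point a b" for a b
    by (auto simp: null_point_def field_simps)
  have mem: "null_point a b \<in> \<Omega> \<longleftrightarrow>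
      0 < A * a + B \<and> 0 < C * a + D \<and> 0 < A' * b + B' \<and> 0 < C' * b + D'" for a b
    by (simp add: \<Omega>_def)
  let ?r = "\<bar>(ln (A * ?u y + B) - ln (C * ?u y + D)) - (ln (A * ?u x + B) - ln (C * ?u x + D))\<bar>"
  let ?r' = "\<bar>(ln (A' * ?w y + B') - ln (C' * ?w y + D')) - (ln (A' * ?w x + B') - ln (C' * ?w x + D'))\<bar>"
  \<comment> \<open>Change one null coordinate at a time: the corner point belongs to
    \<open>\<Omega>\<close> because \<open>\<Omega>\<close> is a product.\<close>
  have "light_step \<Omega> (null_point (?u x) (?w x)) (null_point (?u y) (?w x)) ?r"
    using light_step_ivl[OF ivl(1) l(1), of "null_point 0 (?w x)" \<Omega> "?u x" "?u y"]
      coords[OF x] coords[OF y] by (simp only: np mem)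
  moreover have "light_step \<Omega> (null_point (?u y) (?w x)) (null_point (?u y) (?w y)) ?r'"
    using light_step_ivl[OF ivl(2) l(2), of "null_point (?u y) 0" \<Omega> "?w x" "?w y"]
      coords[OF x] coords[OF y] by (simp only: np mem)
  ultimately have chain: "light_chain \<Omega> x y (?r + ?r')"
    using light_chain.snoc[OF light_chain.single] by fastforce
  then show "\<exists>r. light_chain \<Omega> x y r" ..
  have "markowitz \<Omega> x y \<le> S"
    using markowitz_le[OF chain] by (simp add: S_def d_def)
  interpret open_polyhedron "{..<4}" "\<lambda>i. [(A, A), (C, C), (A', - A'), (C', - C')] ! i"
    "\<lambda>i. [B, D, B', D'] ! i" \<Omega>
    unfolding \<Omega>_def by (rule null_box_polyhedron)
  have ip: "(A, A) \<bullet> z = A * ?u z" "(A, - A) \<bullet> z = A * ?w z" for A z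
    by (simp_all add: ucoord_def wcoord_def inner_prod_def algebra_simps)
  have four: "(\<Sum>i<4. f i) = f 0 + f 1 + f 2 + f 3" for f :: "nat \<Rightarrow> real"
    by (simp add: numeral_eq_Suc)
  have H: "hilbert \<Omega> x y \<le> S"
    using hilbert_le_sum[OF x y] by (simp add: four ip S_def d_def)
  have "S \<le> 4 * hilbert \<Omega> x y"
    using hilbert_ge[OF x y, of 0] hilbert_ge[OF x y, of 1] hilbert_ge[OF x y, of 2]
      hilbert_ge[OF x y, of 3] by (simp add: ip S_def d_def)
  with \<open>markowitz \<Omega> x y \<le> S\<close> show "markowitz \<Omega> x y \<le> 4 * hilbert \<Omega> x y" by simp
  have "S \<le> 4 * r" if r: "light_chain \<Omega> x y r" for r
  proof -
    have "d A B (?u x) (?u y) \<le> r" "d C D (?u x) (?u y) \<le> r"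
      "d A' B' (?w x) (?w y) \<le> r" "d C' D' (?w x) (?w y) \<le> r"
      using light_chain_ge[OF r, of "(A, A)" B] light_chain_ge[OF r, of "(C, C)" D]
        light_chain_ge[OF r, of "(A', - A')" B'] light_chain_ge[OF r, of "(C', - C')" D'] coords
      by (simp_all add: ip d_def)
    then show ?thesis by (simp add: S_def)
  qed
  then have "S / 4 \<le> markowitz \<Omega> x y"
    unfolding markowitz_eq using chain by (intro cInf_greatest) (auto simp: field_simps)
  with H show "hilbert \<Omega> x y \<le> 4 * markowitz \<Omega> x y" by simp
qed

section \<open>Proper open intervals and their products\<close>

definition proper_open_interval :: "real set \<Rightarrow> bool" where
  "proper_open_interval P \<longleftrightarrow> open P \<and> convex P \<and> P \<noteq> {} \<and> P \<noteq> UNIV"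

lemma proper_open_interval_cases:
  fixes P :: "real set"
  assumes P: "proper_open_interval P"
  obtains l where "P = {l<..}" | r where "P = {..<r}" | l r where "l < r" "P = {l<..<r}"
proof -
  from P have P: "open P" "convex P" "P \<noteq> {}" "P \<noteq> UNIV"
    by (simp_all add: proper_open_interval_def)
  then have "is_interval P" by (simp add: is_interval_convex_1)
  from is_real_interval[OF this] obtain a b where ab: "P = {} \<or> P = UNIV \<or> P = {..<b} \<or>
      P = {..b} \<or> P = {a<..} \<or> P = {a..} \<or> P = {a<..<b} \<or> P = {a<..b} \<or> P = {a..<b} \<or> P = {a..b}"
    by (elim exE) (rule that)
  have int: "interior P = P" using P by (simp add: interior_open)
  from ab have "P = {..<b} \<or> P = {a<..} \<or> P = {a<..<b}"
  proof (elim disjE)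
    assume "P = {..b}" with int show ?thesis by simp
  next
    assume "P = {a..}" with int show ?thesis by simp
  next
    assume "P = {a<..b}" with int show ?thesis by simp
  next
    assume "P = {a..<b}" with int show ?thesis by simp
  next
    assume "P = {a..b}" with int show ?thesis by simp
  qed (use P(3,4) in simp_all)
  then show ?thesis
  proof (elim disjE)
    assume "P = {a<..<b}"
    moreover from this P(3) have "a < b" by auto
    ultimately show ?thesis using that(3) by blast
  qed (use that(1,2) in blast)+
qed

lemma proper_open_interval_coeffs:
  fixes P :: "real set"
  assumes P: "proper_open_interval P"
  obtains A B C D where "ivl_coeffs A B C D" "P = {a. 0 < A * a + B \<and> 0 < C * a + D}"
  using assms
proof (cases rule: proper_open_interval_cases)
  case (1 l)
  then show ?thesis by (intro that[of 1 "- l" 0 1]) (auto simp: ivl_coeffs_def)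
next
  case (2 r)
  then show ?thesis by (intro that[of 0 1 "- 1" r]) (auto simp: ivl_coeffs_def)
next
  case (3 l r)
  then show ?thesis by (intro that[of 1 "- l" "- 1" r]) (auto simp: ivl_coeffs_def)
qed

lemma null_box_comparison:
  assumes "proper_open_interval P" "proper_open_interval Q" "x \<in> null_box P Q" "y \<in> null_box P Q"
  shows "\<exists>r. light_chain (null_box P Q) x y r"
    and "markowitz (null_box P Q) x y \<le> 4 * hilbert (null_box P Q) x y"
    and "hilbert (null_box P Q) x y \<le> 4 * markowitz (null_box P Q) x y"
proof -
  obtain A B C D where P: "ivl_coeffs A B C D" "P = {a. 0 < A * a + B \<and> 0 < C * a + D}"
    using assms(1) by (rule proper_open_interval_coeffs)
  obtain A' B' C' D' where Q: "ivl_coeffs A' B' C' D'" "Q = {a. 0 < A' * a + B' \<and> 0 < C' * a + D'}"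
    using assms(2) by (rule proper_open_interval_coeffs)
  note * = assms(3,4)[unfolded P(2) Q(2)]
  show "\<exists>r. light_chain (null_box P Q) x y r"
    and "markowitz (null_box P Q) x y \<le> 4 * hilbert (null_box P Q) x y"
    and "hilbert (null_box P Q) x y \<le> 4 * markowitz (null_box P Q) x y"
    unfolding P(2) Q(2)
    using null_box_chain[OF P(1) Q(1) *] markowitz_le_hilbert_null_box[OF P(1) Q(1) *]
      hilbert_le_markowitz_null_box[OF P(1) Q(1) *] by auto
qed

lemma null_box_equivalent:
  assumes "proper_open_interval P" "proper_open_interval Q"
  shows "markowitz_hilbert_equivalent (null_box P Q)"
    and "quasi_isometrically_equivalent (null_box P Q)
      (markowitz (null_box P Q)) (hilbert (null_box P Q))"
proof -
  let ?\<Omega> = "null_box P Q"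
  show "markowitz_hilbert_equivalent ?\<Omega>"
    unfolding markowitz_hilbert_equivalent_def
    using null_box_comparison(2)[OF assms] by (intro exI[of _ 4]) auto
  have "1 / 4 * markowitz ?\<Omega> x y - 1 \<le> hilbert ?\<Omega> x y \<and>
      hilbert ?\<Omega> x y \<le> 4 * markowitz ?\<Omega> x y + 1" if "x \<in> ?\<Omega>" "y \<in> ?\<Omega>" for x y
    using null_box_comparison(2,3)[OF assms that] by simp
  then show "quasi_isometrically_equivalent ?\<Omega> (markowitz ?\<Omega>) (hilbert ?\<Omega>)"
    unfolding quasi_isometrically_equivalent_def
    by (intro exI[of _ 4] exI[of _ 1] conjI ballI) simp_all
qed

section \<open>Convex domains that are not null boxes\<close>

lemma open_null_box: "open P \<Longrightarrow> open Q \<Longrightarrow> open (null_box P Q)"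
proof -
  assume "open P" "open Q"
  then have "open (ucoord -` P)" "open (wcoord -` Q)"
    unfolding ucoord_def wcoord_def by (auto intro!: open_vimage continuous_intros)
  moreover have "null_box P Q = ucoord -` P \<inter> wcoord -` Q" by (auto simp: null_box_def)
  ultimately show ?thesis by auto
qed

lemma proper_open_interval_greaterThanLessThan: "l < r \<Longrightarrow> proper_open_interval {l<..<r}"
  by (auto simp: proper_open_interval_def dest: arg_cong[of _ UNIV "\<lambda>S. r \<in> S"])

lemma norm_null_le: "norm x \<le> \<bar>ucoord x\<bar> + \<bar>wcoord x\<bar>"
proof -
  have "norm x \<le> \<bar>fst x\<bar> + \<bar>snd x\<bar>"
    using norm_Pair_le[of "fst x" "snd x"] by simp
  then show ?thesis by (simp add: ucoord_def wcoord_def)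
qed

text \<open>Being joined by a chain is an equivalence relation whose classes are open, since a small
  null box around a point lies in its class. It ensures that \<open>markowitz\<close> is the infimum
  of a nonempty set.\<close>

lemma light_chain_exists:
  assumes "open \<Omega>" "connected \<Omega>" "x \<in> \<Omega>" "y \<in> \<Omega>"
  shows "\<exists>r. light_chain \<Omega> x y r"
proof (rule connected_equivalence_relation[OF assms(2-4)])
  show "\<exists>r. light_chain \<Omega> b a r" if "\<exists>r. light_chain \<Omega> a b r" for a b
    using that light_chain_commute by blast
  show "\<exists>r. light_chain \<Omega> a c r" if "\<exists>r. light_chain \<Omega> a b r" "\<exists>r. light_chain \<Omega> b c r" for a b c
    using that light_chain_trans by blast
  fix a assume "a \<in> \<Omega>"
  with \<open>open \<Omega>\<close> obtain e where e: "e > 0" "ball a e \<subseteq> \<Omega>" by (auto simp: open_contains_ball)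
  define P Q where "P = {ucoord a - e/2<..<ucoord a + e/2}" and "Q = {wcoord a - e/2<..<wcoord a + e/2}"
  have PQ: "proper_open_interval P" "proper_open_interval Q"
    unfolding P_def Q_def using e by (auto intro!: proper_open_interval_greaterThanLessThan)
  have "z \<in> ball a e" if "z \<in> null_box P Q" for z
  proof -
    have "\<bar>ucoord (z - a)\<bar> < e/2" "\<bar>wcoord (z - a)\<bar> < e/2"
      using that unfolding linear_diff[OF linear_ucoord] linear_diff[OF linear_wcoord]
      by (simp_all only: null_box_def P_def Q_def mem_Collect_eq greaterThanLessThan_iff) linarith+
    with norm_null_le[of "z - a"] show ?thesis by (simp add: dist_norm norm_minus_commute)
  qed
  with e have sub: "null_box P Q \<subseteq> \<Omega>" by blast
  have "a \<in> null_box P Q" using e by (simp add: null_box_def P_def Q_def)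
  then have "\<exists>r. light_chain \<Omega> a z r" if "z \<in> null_box P Q" for z
    using null_box_comparison(1)[OF PQ _ that] light_chain_mono[OF _ sub] by blast
  moreover have "openin (top_of_set \<Omega>) (null_box P Q)"
    using PQ sub by (intro open_subset open_null_box) (auto simp: proper_open_interval_def)
  ultimately show "\<exists>T. openin (top_of_set \<Omega>) T \<and> a \<in> T \<and> (\<forall>z\<in>T. \<exists>r. light_chain \<Omega> a z r)"
    using \<open>a \<in> null_box P Q\<close> by blast
qed

text \<open>The distance to the complement of \<open>\<Omega>\<close> is positive at \<open>z\<close> and vanishes at \<open>q\<close>, so somewhere on
  the segment it takes a prescribed small value: the ball with that radius touches the complement,
  at a point of \<open>U\<close>.\<close>

lemma touching_ball:
  fixes \<Omega> :: "'a::euclidean_space set"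
  assumes \<Omega>: "open \<Omega>" "convex \<Omega>" and z: "z \<in> \<Omega>" and q: "q \<notin> \<Omega>"
    and U: "open U" "closed_segment z q \<subseteq> U"
  obtains c p where "c \<noteq> p" "ball c (norm (c - p)) \<subseteq> \<Omega>" "p \<in> U"
    "\<And>x. x \<in> \<Omega> \<Longrightarrow> 0 < (c - p) \<bullet> (x - p)"
proof -
  obtain e where e: "e > 0" "(\<Union>x\<in>closed_segment z q. ball x e) \<subseteq> U"
    using compact_subset_open_imp_ball_epsilon_subset[OF compact_segment U] .
  define f where "f c = infdist c (- \<Omega>)" for c
  have cl: "closed (- \<Omega>)" "- \<Omega> \<noteq> {}" using \<Omega>(1) q by (simp add: closed_Compl, blast)
  have fz: "f z > 0" unfolding f_def using infdist_pos_not_in_closed[OF cl] z by simp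
  have fq: "f q = 0" using q by (simp add: f_def)
  \<comment> \<open>The first entry puts \<open>r\<close> in the range of the intermediate value
    theorem, the second keeps the contact point within \<open>e\<close> of the segment, hence in
    \<open>U\<close>.\<close>
  define r where "r = min (f z) (e / 2)"
  have r: "0 < r" "r \<le> f z" "r < e" using fz e by (auto simp: r_def)
  have "continuous_on {0..1} (\<lambda>t. f (linepath z q t))"
    unfolding f_def by (intro continuous_on_infdist continuous_on_linepath)
  moreover have "f (linepath z q 1) \<le> r" "r \<le> f (linepath z q 0)"
    using r fq by (simp_all add: linepath_0' linepath_1')
  ultimately obtain t where t: "0 \<le> t" "t \<le> 1" "f (linepath z q t) = r"
    using IVT2'[of "\<lambda>t. f (linepath z q t)" 1 r 0] zero_le_one by blast
  define c where "c = linepath z q t"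
  have c: "c \<in> closed_segment z q" unfolding c_def using t by (intro linepath_in_path) auto
  have fc: "f c = r" using t by (simp add: c_def)
  from infdist_attains_inf[OF cl, of c] obtain p where "p \<in> - \<Omega>" "infdist c (- \<Omega>) = dist c p" .
  with fc have p: "p \<notin> \<Omega>" "dist c p = r" by (simp_all add: f_def)
  have ball: "ball c r \<subseteq> \<Omega>"
  proof
    fix x assume "x \<in> ball c r"
    then have "\<not> infdist c (- \<Omega>) \<le> dist c x" using fc by (simp add: f_def)
    then show "x \<in> \<Omega>" using infdist_le[of x "- \<Omega>" c] by blast
  qed
  have rn: "norm (c - p) = r" using p by (simp add: dist_norm)
  have "\<exists>a b. a \<noteq> 0 \<and> (\<forall>x\<in>\<Omega>. a \<bullet> x \<le> b) \<and> (\<forall>x\<in>{p}. a \<bullet> x \<ge> b)"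
    by (rule separating_hyperplane_sets) (use \<Omega> z p in auto)
  then obtain a b where ab: "a \<noteq> 0" "\<forall>x\<in>\<Omega>. a \<bullet> x \<le> b" "b \<le> a \<bullet> p" by auto
  have "a \<bullet> x \<le> a \<bullet> p" if "x \<in> \<Omega>" for x
    using ab(2,3) that order_trans by blast
  note a = \<open>a \<noteq> 0\<close> this
  have strict: "a \<bullet> x < a \<bullet> p" if x: "x \<in> \<Omega>" for x
  proof -
    obtain d where d: "d > 0" "ball x d \<subseteq> \<Omega>" using \<Omega>(1) x by (auto simp: open_contains_ball)
    have "x + (d / 2 / norm a) *\<^sub>R a \<in> ball x d" using d a by (simp add: dist_norm)
    with d a(2) have "a \<bullet> (x + (d / 2 / norm a) *\<^sub>R a) \<le> a \<bullet> p" by blast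
    moreover have "0 < (d / 2 / norm a) * (a \<bullet> a)" using d a by simp
    ultimately show ?thesis by (simp add: inner_add_right)
  qed
  \<comment> \<open>The supporting line at \<open>p\<close> misses the ball, so its distance from
    \<open>c\<close> is at least \<open>r\<close>, which is also the distance from \<open>c\<close>
    to \<open>p\<close>. Equality in the Cauchy-Schwarz inequality then makes its normal parallel to
    the radius.\<close>
  have "r \<le> a \<bullet> (p - c) / norm a"
  proof (rule dense_le_bounded[OF r(1)])
    fix s assume s: "0 < s" "s < r"
    have "c + (s / norm a) *\<^sub>R a \<in> ball c r" using s a by (simp add: dist_norm)
    with ball a(2) have "a \<bullet> (c + (s / norm a) *\<^sub>R a) \<le> a \<bullet> p" by blast
    moreover have "(s / norm a) * (a \<bullet> a) = s * norm a"
      using a by (simp add: power2_norm_eq_inner[symmetric] power2_eq_square)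
    ultimately have "a \<bullet> c + s * norm a \<le> a \<bullet> p"
      by (simp only: inner_add_right inner_scaleR_right)
    then show "s \<le> a \<bullet> (p - c) / norm a"
      using a by (simp add: inner_diff_right pos_le_divide_eq)
  qed
  then have "norm a * norm (p - c) \<le> a \<bullet> (p - c)"
    using a rn by (simp add: field_simps norm_minus_commute)
  then have "a \<bullet> (p - c) = norm a * norm (p - c)"
    using norm_cauchy_schwarz[of a "p - c"] by linarith
  from iffD1[OF norm_cauchy_schwarz_eq this] have "norm a *\<^sub>R (p - c) = r *\<^sub>R a"
    using rn by (simp only: norm_minus_commute)
  moreover have "norm a *\<^sub>R (c - p) = - (norm a *\<^sub>R (p - c))"
    by (simp add: scaleR_diff_right)
  ultimately have par: "norm a *\<^sub>R (c - p) = - (r *\<^sub>R a)"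
    by (simp only:)
  have pos: "0 < (c - p) \<bullet> (x - p)" if "x \<in> \<Omega>" for x
  proof -
    have "norm a * ((c - p) \<bullet> (x - p)) = (norm a *\<^sub>R (c - p)) \<bullet> (x - p)" by simp
    also have "\<dots> = r * (a \<bullet> p - a \<bullet> x)" unfolding par by (simp add: inner_diff_right algebra_simps)
    also have "\<dots> > 0" using strict[OF that] r by simp
    finally show ?thesis using a by (simp add: zero_less_mult_iff)
  qed
  show ?thesis
  proof (rule that[of c p])
    show "c \<noteq> p" using r rn by auto
    show "ball c (norm (c - p)) \<subseteq> \<Omega>" using ball rn by simp
    have "p \<in> ball c e" using p r by simp
    with e(2) c show "p \<in> U" by blast
    show "0 < (c - p) \<bullet> (x - p)" if "x \<in> \<Omega>" for x using pos that .
  qed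
qed

section \<open>Divergence of the two distances at a touching point\<close>

lemma hilbert_term_le_1:
  assumes "\<And>s. 0 \<le> s \<Longrightarrow> s < 1 \<Longrightarrow> x + s *\<^sub>R v \<in> \<Omega>"
  shows "hilbert_term \<Omega> x v \<le> 1"
proof (cases "bdd_above {s. x + s *\<^sub>R v \<in> \<Omega>}")
  case True
  have "1 \<le> Sup {s. x + s *\<^sub>R v \<in> \<Omega>}"
    by (rule dense_le_bounded[of 0]) (use assms in \<open>auto intro!: cSup_upper True\<close>)
  then show ?thesis using True
    by (simp add: hilbert_term_def dist_norm divide_le_eq mult_le_cancel_right1)
qed (simp add: hilbert_term_def)

text \<open>From each point of the segment the chord continues on both sides by at least the vector
  \<open>y - x\<close>, so either term of the Finsler metric is at most 1.\<close>

lemma hilbert_le_2: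
  assumes "\<And>s. -2 < s \<Longrightarrow> s < 2 \<Longrightarrow> x + s *\<^sub>R (y - x) \<in> \<Omega>"
  shows "hilbert \<Omega> x y \<le> 2"
proof (rule hilbert_le_linepath[of _ _ _ "\<lambda>_. 2"])
  have lp: "linepath x y u = x + u *\<^sub>R (y - x)" for u
    by (simp add: linepath_def algebra_simps)
  show "closed_segment x y \<subseteq> \<Omega>"
    unfolding linepath_image_01[symmetric] using assms by (auto simp: lp)
  show "((\<lambda>_. 2::real) has_integral 2) {0..1::real}"
    using has_integral_const_real[of "2::real" 0 1] by simp
  fix u :: real assume u: "u \<in> {0..1}"
  have *: "linepath x y u + s *\<^sub>R (y - x) \<in> \<Omega>" if "-2 < u + s" "u + s < 2" for s
    using assms[OF that] by (simp add: lp scaleR_add_left add.assoc)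
  have "hilbert_term \<Omega> (linepath x y u) (y - x) \<le> 1"
    using u by (intro hilbert_term_le_1 *) auto
  moreover have "hilbert_term \<Omega> (linepath x y u) (- (y - x)) \<le> 1"
  proof (rule hilbert_term_le_1)
    fix s :: real assume "0 \<le> s" "s < 1"
    with u have "linepath x y u + (- s) *\<^sub>R (y - x) \<in> \<Omega>" by (intro *) auto
    then show "linepath x y u + s *\<^sub>R - (y - x) \<in> \<Omega>"
      by (simp only: scaleR_minus_left scaleR_minus_right)
  qed
  ultimately show "hilbert_finsler \<Omega> (linepath x y u) (y - x) \<le> 2"
    by (simp add: hilbert_finsler_def)
qed

lemma inner_null: "x \<bullet> y = (ucoord x * ucoord y + wcoord x * wcoord y) / 2"
  by (simp add: inner_prod_def ucoord_def wcoord_def field_simps)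

text \<open>A lightlike vector has only one nonzero null coordinate, so a single product remains in
  \<open>inner_null\<close>. The constant is positive when neither null coordinate of
  \<open>n\<close> vanishes, that is, when the line normal to \<open>n\<close> is not
  lightlike.\<close>

lemma lightlike_inner_bound:
  assumes "lightlike v"
  shows "min \<bar>ucoord n\<bar> \<bar>wcoord n\<bar> / 2 * norm v \<le> \<bar>n \<bullet> v\<bar>"
proof -
  have le: "min \<bar>ucoord n\<bar> \<bar>wcoord n\<bar> / 2 * norm v \<le>
      min \<bar>ucoord n\<bar> \<bar>wcoord n\<bar> / 2 * (\<bar>ucoord v\<bar> + \<bar>wcoord v\<bar>)"
    using norm_null_le[of v] by (intro mult_left_mono) auto
  from assms consider "ucoord v = 0" | "wcoord v = 0" by (auto simp: lightlike_iff)
  then show ?thesis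
  proof cases
    case 1
    have "min \<bar>ucoord n\<bar> \<bar>wcoord n\<bar> * \<bar>wcoord v\<bar> \<le> \<bar>wcoord n\<bar> * \<bar>wcoord v\<bar>"
      by (intro mult_right_mono) auto
    with le 1 show ?thesis by (simp add: inner_null abs_mult)
  next
    case 2
    have "min \<bar>ucoord n\<bar> \<bar>wcoord n\<bar> * \<bar>ucoord v\<bar> \<le> \<bar>ucoord n\<bar> * \<bar>ucoord v\<bar>"
      by (intro mult_right_mono) auto
    with le 2 show ?thesis by (simp add: inner_null abs_mult)
  qed
qed

text \<open>At height of order \<open>q\<^sup>2\<close> above the tangent line, the chord of the ball parallel to it has
  length of order \<open>q\<close>.  Two points of the chord at distance of order \<open>q\<close> are thus at bounded
  Hilbert distance, while every chain of lightlike segments between them costs at least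
  \<open>ln (1 / q)\<close> up to a constant.\<close>

lemma no_comparison_at_touching_ball:
  assumes \<Omega>: "open \<Omega>" "connected \<Omega>"
    and ball: "ball c (norm (c - p)) \<subseteq> \<Omega>" "\<And>x. x \<in> \<Omega> \<Longrightarrow> 0 < (c - p) \<bullet> (x - p)"
    and nonlight: "ucoord (c - p) \<noteq> 0" "wcoord (c - p) \<noteq> 0" and \<alpha>: "0 \<le> \<alpha>"
  shows "\<exists>x\<in>\<Omega>. \<exists>y\<in>\<Omega>. \<alpha> * hilbert \<Omega> x y + \<beta> < markowitz \<Omega> x y"
proof -
  define n where "n = c - p"
  define r where "r = norm n"
  define \<kappa> where "\<kappa> = min \<bar>ucoord n\<bar> \<bar>wcoord n\<bar> / 2"
  have \<kappa>: "0 < \<kappa>" using nonlight by (simp add: \<kappa>_def n_def)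
  have "n \<noteq> 0" using nonlight linear_0[OF linear_ucoord] by (auto simp: n_def)
  then have r: "0 < r" by (simp add: r_def)
  have nn: "n \<bullet> n = r\<^sup>2" by (simp add: r_def power2_norm_eq_inner)
  define \<tau> where "\<tau> = (- snd n, fst n)"
  have \<tau>: "n \<bullet> \<tau> = 0" "\<tau> \<bullet> \<tau> = r\<^sup>2"
    by (simp_all add: \<tau>_def nn[symmetric] inner_prod_def algebra_simps)
  then have norm_\<tau>: "norm \<tau> = r" using r by (simp add: norm_eq_sqrt_inner)
  \<comment> \<open>Larger than \<open>\<alpha> * H + \<beta>\<close> for every
    \<open>H \<le> 2\<close>.\<close>
  define M where "M = 2 * \<alpha> + \<bar>\<beta>\<bar> + 1"
  \<comment> \<open>The first entry keeps \<open>q\<close> below 1, hence the chord inside the ball;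
    the second lets the final inequality \<open>\<kappa> \<le> 2 * (q * r) * exp \<rho>\<close>
    force \<open>M \<le> \<rho>\<close>.\<close>
  define q where "q = min (1 / 2) (\<kappa> / (2 * r * exp M))"
  have q: "0 < q" "q < 1" "q * (2 * r * exp M) \<le> \<kappa>"
  proof -
    show "0 < q" "q < 1" using \<kappa> r by (auto simp: q_def)
    have "q \<le> \<kappa> / (2 * r * exp M)" by (simp add: q_def)
    then show "q * (2 * r * exp M) \<le> \<kappa>" using r by (simp add: pos_le_divide_eq)
  qed
  \<comment> \<open>The half chord of the ball through \<open>x\<close> has length \<open>r\<close>
    times the square root of \<open>2 * q^2 - q^4\<close>, which exceeds \<open>q * r\<close>. With
    the step \<open>q / 2\<close> in \<open>y\<close>, parameters of modulus below 2 therefore stay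
    inside.\<close>
  define x where "x = p + q\<^sup>2 *\<^sub>R n"
  define y where "y = x + (q / 2) *\<^sub>R \<tau>"
  have chord: "x + s *\<^sub>R (y - x) \<in> \<Omega>" if s: "-2 < s" "s < 2" for s
  proof -
    let ?m = "s * (q / 2)"
    have eq: "x + s *\<^sub>R (y - x) - c = (q\<^sup>2 - 1) *\<^sub>R n + ?m *\<^sub>R \<tau>"
      by (simp add: y_def x_def n_def algebra_simps)
    have "norm (x + s *\<^sub>R (y - x) - c) ^ 2 = ((q\<^sup>2 - 1)\<^sup>2 + ?m\<^sup>2) * r\<^sup>2"
      unfolding eq power2_norm_eq_inner
      using \<tau> nn by (simp add: inner_add_left inner_add_right inner_commute[of \<tau> n] power2_eq_square
          algebra_simps)
    also have "\<dots> < 1 * r\<^sup>2"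
    proof (rule mult_strict_right_mono)
      have "\<bar>s\<bar> < 2" using s by linarith
      then have "s\<^sup>2 < 2\<^sup>2" using power_strict_mono[of "\<bar>s\<bar>" 2 2] by simp
      then have "s\<^sup>2 * q\<^sup>2 < 4 * q\<^sup>2" using q(1) by simp
      then have "?m\<^sup>2 < q\<^sup>2" by (simp add: power_mult_distrib power_divide)
      moreover have "q\<^sup>2 * q\<^sup>2 < q\<^sup>2 * 1" using q by (intro mult_strict_left_mono) (auto simp: power_less_one_iff)
      moreover have "(q\<^sup>2 - 1)\<^sup>2 = q\<^sup>2 * q\<^sup>2 - 2 * q\<^sup>2 + 1" by (simp add: power2_eq_square algebra_simps)
      ultimately show "(q\<^sup>2 - 1)\<^sup>2 + ?m\<^sup>2 < 1" by linarith
    qed (use r in simp)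
    finally have "norm (x + s *\<^sub>R (y - x) - c) < r"
      using r by (simp add: power_less_imp_less_base)
    then show ?thesis
      using ball(1) by (auto simp: dist_norm norm_minus_commute r_def n_def)
  qed
  have xy: "x \<in> \<Omega>" "y \<in> \<Omega>" using chord[of 0] chord[of 1] by auto
  have H: "hilbert \<Omega> x y \<le> 2" using chord by (rule hilbert_le_2)
  have "M \<le> \<rho>" if \<rho>: "light_chain \<Omega> x y \<rho>" for \<rho>
  proof -
    have "\<kappa> * norm (y - x) \<le> (n \<bullet> x + - (n \<bullet> p)) * (exp \<rho> - 1)"
    proof (rule light_chain_displacement[OF \<rho>])
      show "0 < n \<bullet> z + - (n \<bullet> p)" if "z \<in> \<Omega>" for z
        using ball(2)[OF that] by (simp add: n_def inner_diff_right)
      show "0 \<le> \<kappa>" using \<kappa> by simp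
      show "\<kappa> * norm v \<le> \<bar>n \<bullet> v\<bar>" if "lightlike v" for v
        using lightlike_inner_bound[OF that] by (simp add: \<kappa>_def)
    qed
    moreover have "n \<bullet> x + - (n \<bullet> p) = q\<^sup>2 * r\<^sup>2" by (simp add: x_def inner_add_right nn)
    moreover have "norm (y - x) = q / 2 * r" using q by (simp add: y_def norm_\<tau>)
    ultimately have "\<kappa> * (q / 2 * r) \<le> q\<^sup>2 * r\<^sup>2 * (exp \<rho> - 1)" by simp
    \<comment> \<open>The displacement is linear in \<open>q\<close> and the height quadratic: after
      cancelling, one factor \<open>q\<close> is left to be compensated by
      \<open>exp \<rho>\<close>.\<close>
    then have "(q * r) * \<kappa> \<le> (q * r) * (2 * (q * r) * (exp \<rho> - 1))"
      by (simp add: power2_eq_square algebra_simps)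
    then have "\<kappa> \<le> 2 * (q * r) * (exp \<rho> - 1)"
      using q r by (simp add: mult_le_cancel_left)
    also have "\<dots> \<le> 2 * (q * r) * exp \<rho>" using q r by (intro mult_left_mono) auto
    finally have "(2 * (q * r)) * exp M \<le> (2 * (q * r)) * exp \<rho>" using q(3) by (simp add: ac_simps)
    then show "M \<le> \<rho>" using q r by (simp add: mult_le_cancel_left)
  qed
  then have "M \<le> markowitz \<Omega> x y"
    unfolding markowitz_eq using light_chain_exists[OF \<Omega> xy] by (intro cInf_greatest) auto
  moreover have "\<alpha> * hilbert \<Omega> x y \<le> \<alpha> * 2" using H \<alpha> by (rule mult_left_mono)
  ultimately have "\<alpha> * hilbert \<Omega> x y + \<beta> < markowitz \<Omega> x y" by (simp add: M_def)
  with xy show ?thesis by blast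
qed

lemma convex_null_box: "convex P \<Longrightarrow> convex Q \<Longrightarrow> convex (null_box P Q)"
proof -
  assume "convex P" "convex Q"
  then have "convex (ucoord -` P)" "convex (wcoord -` Q)"
    using convex_linear_vimage linear_ucoord linear_wcoord by blast+
  moreover have "null_box P Q = ucoord -` P \<inter> wcoord -` Q" by (auto simp: null_box_def)
  ultimately show ?thesis by (simp add: convex_Int)
qed

lemma surj_ucoord: "surj ucoord"
  by (rule surjI[of _ "\<lambda>a. null_point a 0"]) simp

lemma surj_wcoord: "surj wcoord"
  by (rule surjI[of _ "null_point 0"]) simp

text \<open>The product hull \<open>?U\<close> of the projections guarantees transversality: for
  \<open>p\<close> in \<open>?U\<close>, each of the two lightlike lines through \<open>p\<close>
  meets \<open>\<Omega>\<close>. The tangent at the contact point misses \<open>\<Omega>\<close>, so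
  it is neither of them.\<close>

lemma comparison_imp_null_box:
  assumes \<Omega>: "open \<Omega>" "convex \<Omega>" and \<alpha>: "0 \<le> \<alpha>"
    and comp: "\<And>x y. x \<in> \<Omega> \<Longrightarrow> y \<in> \<Omega> \<Longrightarrow> markowitz \<Omega> x y \<le> \<alpha> * hilbert \<Omega> x y + \<beta>"
  shows "\<Omega> = null_box (ucoord ` \<Omega>) (wcoord ` \<Omega>)"
proof (rule ccontr)
  let ?U = "null_box (ucoord ` \<Omega>) (wcoord ` \<Omega>)"
  assume "\<Omega> \<noteq> ?U"
  moreover have sub: "\<Omega> \<subseteq> ?U" by (auto simp: null_box_def)
  ultimately obtain q where q: "q \<in> ?U" "q \<notin> \<Omega>" by blast
  then obtain z where z: "z \<in> \<Omega>" by (auto simp: null_box_def)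
  have U: "open ?U" "convex ?U"
    using \<Omega> by (auto intro!: open_null_box convex_null_box open_surjective_linear_image
        convex_linear_image linear_ucoord linear_wcoord surj_ucoord surj_wcoord)
  then have seg: "closed_segment z q \<subseteq> ?U"
    using z q sub by (auto simp: convex_contains_segment)
  obtain c p where
    "c \<noteq> p" and ball: "ball c (norm (c - p)) \<subseteq> \<Omega>" and p: "p \<in> ?U"
    and half: "\<And>x. x \<in> \<Omega> \<Longrightarrow> 0 < (c - p) \<bullet> (x - p)"
    by (rule touching_ball[OF \<Omega> z q(2) U(1) seg]) (rule that)
  from p obtain a b where ab: "a \<in> \<Omega>" "ucoord a = ucoord p" "b \<in> \<Omega>" "wcoord b = wcoord p"
    by (auto simp: null_box_def)
  have "wcoord (c - p) \<noteq> 0" "ucoord (c - p) \<noteq> 0"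
    using half[OF ab(1)] half[OF ab(3)] ab(2,4)
    by (auto simp: inner_null linear_diff[OF linear_ucoord] linear_diff[OF linear_wcoord])
  from no_comparison_at_touching_ball[OF \<Omega>(1) convex_connected[OF \<Omega>(2)] ball half this(2,1) \<alpha>]
  obtain x y where "x \<in> \<Omega>" "y \<in> \<Omega>" "\<alpha> * hilbert \<Omega> x y + \<beta> < markowitz \<Omega> x y" by blast
  with comp[of x y] show False by simp
qed

text \<open>A factor equal to the whole real line would put a complete lightlike line into
  \<open>\<Omega>\<close>.\<close>

lemma proper_open_interval_coords:
  assumes "\<Omega> = null_box P Q" "open \<Omega>" "convex \<Omega>" "\<Omega> \<noteq> {}" "contains_no_line \<Omega>"
  shows "proper_open_interval P" "proper_open_interval Q"
proof -
  from assms obtain z where z: "z \<in> \<Omega>" by blast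
  have "ucoord ` \<Omega> = P" "wcoord ` \<Omega> = Q"
  proof -
    show "ucoord ` \<Omega> = P"
    proof
      show "P \<subseteq> ucoord ` \<Omega>"
      proof
        fix a assume "a \<in> P"
        then have "null_point a (wcoord z) \<in> \<Omega>" using z assms(1) by (simp add: null_box_def)
        then show "a \<in> ucoord ` \<Omega>" by (metis imageI ucoord_null_point)
      qed
    qed (auto simp: assms(1) null_box_def)
    show "wcoord ` \<Omega> = Q"
    proof
      show "Q \<subseteq> wcoord ` \<Omega>"
      proof
        fix a assume "a \<in> Q"
        then have "null_point (ucoord z) a \<in> \<Omega>" using z assms(1) by (simp add: null_box_def)
        then show "a \<in> wcoord ` \<Omega>" by (metis imageI wcoord_null_point)
      qed
    qed (auto simp: assms(1) null_box_def)
  qed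
  then have "open P" "open Q" "convex P" "convex Q" "P \<noteq> {}" "Q \<noteq> {}"
    using assms(2-4) open_surjective_linear_image[OF _ linear_ucoord surj_ucoord]
      open_surjective_linear_image[OF _ linear_wcoord surj_wcoord]
      convex_linear_image[OF linear_ucoord] convex_linear_image[OF linear_wcoord] by auto
  moreover have "P \<noteq> UNIV"
  proof
    assume "P = UNIV"
    then have "range (\<lambda>s. z + s *\<^sub>R null_point 1 0) \<subseteq> \<Omega>"
      using z unfolding assms(1) null_box_def
      by (auto simp: linear_add[OF linear_wcoord] linear_scale[OF linear_wcoord])
    moreover have "null_point 1 0 \<noteq> 0" by (simp add: null_point_def zero_prod_def)
    ultimately show False using assms(5) unfolding contains_no_line_def by blast
  qed
  moreover have "Q \<noteq> UNIV"
  proof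
    assume "Q = UNIV"
    then have "range (\<lambda>s. z + s *\<^sub>R null_point 0 1) \<subseteq> \<Omega>"
      using z unfolding assms(1) null_box_def
      by (auto simp: linear_add[OF linear_ucoord] linear_scale[OF linear_ucoord])
    moreover have "null_point 0 1 \<noteq> 0" by (simp add: null_point_def zero_prod_def)
    ultimately show False using assms(5) unfolding contains_no_line_def by blast
  qed
  ultimately show "proper_open_interval P" "proper_open_interval Q"
    by (simp_all add: proper_open_interval_def)
qed

section \<open>Classification of null boxes\<close>

lemma mform_diff_null:
  "mform (y - x) (y - x) = - ((ucoord y - ucoord x) * (wcoord y - wcoord x))"
  by (simp add: mform_null linear_diff[OF linear_ucoord] linear_diff[OF linear_wcoord])

lemma fst_diff_null: "fst (y - x) = ((ucoord y - ucoord x) + (wcoord y - wcoord x)) / 2"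
  by (simp add: ucoord_def wcoord_def field_simps)

text \<open>With \<open>a\<close> and \<open>b\<close> the null coordinates of a difference, the
  product gives the causal character and the sum the time orientation; together they amount to a
  sign for each coordinate.\<close>

lemma mult_add_signs:
  fixes a b :: real
  shows "0 < a * b \<and> 0 < (a + b) / 2 \<longleftrightarrow> 0 < a \<and> 0 < b"
    and "0 < a * b \<and> (a + b) / 2 < 0 \<longleftrightarrow> a < 0 \<and> b < 0"
    and "0 \<le> a * b \<and> 0 \<le> (a + b) / 2 \<longleftrightarrow> 0 \<le> a \<and> 0 \<le> b"
    and "0 \<le> a * b \<and> (a + b) / 2 \<le> 0 \<longleftrightarrow> a \<le> 0 \<and> b \<le> 0"
  by (auto simp: zero_less_mult_iff zero_le_mult_iff)

lemma chron_future_null: "chron_future x = null_box {ucoord x<..} {wcoord x<..}"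
proof (rule set_eqI)
  fix y
  show "y \<in> chron_future x \<longleftrightarrow> y \<in> null_box {ucoord x<..} {wcoord x<..}"
    unfolding chron_future_def mem_Collect_eq mform_diff_null fst_diff_null neg_less_0_iff_less
      mult_add_signs by (simp add: null_box_def)
qed

lemma chron_past_null: "chron_past x = null_box {..<ucoord x} {..<wcoord x}"
proof (rule set_eqI)
  fix y
  show "y \<in> chron_past x \<longleftrightarrow> y \<in> null_box {..<ucoord x} {..<wcoord x}"
    unfolding chron_past_def mem_Collect_eq mform_diff_null fst_diff_null neg_less_0_iff_less
      mult_add_signs by (simp add: null_box_def)
qed

lemma causal_complement_null:
  "UNIV - (causal_future x \<union> causal_past x) =
    null_box {ucoord x<..} {..<wcoord x} \<union> null_box {..<ucoord x} {wcoord x<..}"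
proof (rule set_eqI)
  fix y
  have "y \<in> causal_future x \<longleftrightarrow> ucoord x \<le> ucoord y \<and> wcoord x \<le> wcoord y"
    unfolding causal_future_def mem_Collect_eq mform_diff_null fst_diff_null neg_le_0_iff_le
      mult_add_signs by simp
  moreover have "y \<in> causal_past x \<longleftrightarrow> ucoord y \<le> ucoord x \<and> wcoord y \<le> wcoord x"
    unfolding causal_past_def mem_Collect_eq mform_diff_null fst_diff_null neg_le_0_iff_le
      mult_add_signs by simp
  ultimately show "y \<in> UNIV - (causal_future x \<union> causal_past x) \<longleftrightarrow>
      y \<in> null_box {ucoord x<..} {..<wcoord x} \<union> null_box {..<ucoord x} {wcoord x<..}"
    by (auto simp: null_box_def)
qed

lemma null_box_Int: "null_box P Q \<inter> null_box P' Q' = null_box (P \<inter> P') (Q \<inter> Q')"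
  by (auto simp: null_box_def)

lemma null_box_empty_iff: "null_box P Q = {} \<longleftrightarrow> P = {} \<or> Q = {}"
proof
  assume "null_box P Q = {}"
  then have "null_point a b \<notin> null_box P Q" for a b by blast
  then show "P = {} \<or> Q = {}" by auto
qed (auto simp: null_box_def)

section \<open>Diamonds, space components and slabs as products\<close>

lemma diamond_iff:
  "diamond \<Omega> \<longleftrightarrow> (\<exists>l r l' r'. l < r \<and> l' < r' \<and> \<Omega> = null_box {l<..<r} {l'<..<r'})"
proof
  assume "diamond \<Omega>"
  then obtain x y where "y \<in> null_box {ucoord x<..} {wcoord x<..}"
    "\<Omega> = null_box {ucoord x<..} {wcoord x<..} \<inter> null_box {..<ucoord y} {..<wcoord y}"
    by (auto simp: diamond_def chron_future_null chron_past_null)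
  then show "\<exists>l r l' r'. l < r \<and> l' < r' \<and> \<Omega> = null_box {l<..<r} {l'<..<r'}"
    unfolding null_box_Int greaterThanLessThan_def[symmetric] by (auto simp: null_box_def)
next
  assume "\<exists>l r l' r'. l < r \<and> l' < r' \<and> \<Omega> = null_box {l<..<r} {l'<..<r'}"
  then obtain l r l' r' where "l < r" "l' < r'" "\<Omega> = null_box {l<..<r} {l'<..<r'}" by blast
  then show "diamond \<Omega>"
    unfolding diamond_def chron_future_null chron_past_null null_box_Int
    by (intro exI[of _ "null_point l l'"] exI[of _ "null_point r r'"])
      (simp add: greaterThanLessThan_def)
qed

lemma components_Un_separated:
  assumes "open A" "open B" "connected A" "connected B" "A \<noteq> {}" "B \<noteq> {}" "A \<inter> B = {}"
  shows "C \<in> components (A \<union> B) \<longleftrightarrow> C = A \<or> C = B"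
proof -
  have in_one: "D \<subseteq> A \<or> D \<subseteq> B" if "connected D" "D \<subseteq> A \<union> B" for D
    using connectedD[OF that(1) assms(1,2)] assms(7) that(2) by blast
  have comp: "C \<in> components (A \<union> B)"
    if "connected C" "C \<noteq> {}" "C = A \<or> C = B" for C
    unfolding in_components_maximal using that in_one assms(7) by blast
  show ?thesis
  proof
    assume C: "C \<in> components (A \<union> B)"
    then have "C \<subseteq> A \<or> C \<subseteq> B"
      using in_one in_components_connected in_components_subset by blast
    with C assms(3-6) show "C = A \<or> C = B"
      unfolding in_components_maximal by blast
  qed (use assms comp in blast)
qed

lemma proper_open_interval_halfline:
  "proper_open_interval {l<..}" "proper_open_interval {..<r}"
  by (auto simp: proper_open_interval_def set_eq_iff gt_ex lt_ex intro: exI[of _ l] exI[of _ r])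

lemma null_box_open_connected_nonempty:
  assumes "proper_open_interval P" "proper_open_interval Q"
  shows "open (null_box P Q)" "connected (null_box P Q)" "null_box P Q \<noteq> {}"
  using assms open_null_box convex_connected[OF convex_null_box]
  by (simp_all add: proper_open_interval_def null_box_empty_iff)

lemma space_component_iff:
  "space_component \<Omega> \<longleftrightarrow>
    (\<exists>l r. \<Omega> = null_box {l<..} {..<r} \<or> \<Omega> = null_box {..<l} {r<..})"
proof -
  have "\<Omega> \<in> components (UNIV - (causal_future x \<union> causal_past x)) \<longleftrightarrow>
      \<Omega> = null_box {ucoord x<..} {..<wcoord x} \<or> \<Omega> = null_box {..<ucoord x} {wcoord x<..}" for x
    unfolding causal_complement_null
  proof (rule components_Un_separated)
    show "null_box {ucoord x<..} {..<wcoord x} \<inter> null_box {..<ucoord x} {wcoord x<..} = {}"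
      by (auto simp: null_box_def)
  qed (intro null_box_open_connected_nonempty proper_open_interval_halfline)+
  then have "space_component \<Omega> \<longleftrightarrow>
      (\<exists>x. \<Omega> = null_box {ucoord x<..} {..<wcoord x} \<or> \<Omega> = null_box {..<ucoord x} {wcoord x<..})"
    by (simp add: space_component_def)
  also have "\<dots> \<longleftrightarrow> (\<exists>l r. \<Omega> = null_box {l<..} {..<r} \<or> \<Omega> = null_box {..<l} {r<..})"
  proof
    assume "\<exists>l r. \<Omega> = null_box {l<..} {..<r} \<or> \<Omega> = null_box {..<l} {r<..}"
    then obtain l r where "\<Omega> = null_box {l<..} {..<r} \<or> \<Omega> = null_box {..<l} {r<..}" by blast
    then show "\<exists>x. \<Omega> = null_box {ucoord x<..} {..<wcoord x} \<or> \<Omega> = null_box {..<ucoord x} {wcoord x<..}"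
      by (intro exI[of _ "null_point l r"]) simp
  qed blast
  finally show ?thesis .
qed

text \<open>\<open>f\<close> and \<open>g\<close> stand for the null coordinates in either order, so
  both families of slabs are covered: \<open>f\<close> is constant along \<open>v\<close> and cuts
  out the slab, \<open>g\<close> locates a point along \<open>v\<close>.\<close>

lemma affine_slab_eq:
  fixes f g :: "mink \<Rightarrow> real"
  assumes f: "linear f" and g: "linear g"
    and inj: "\<forall>x y. f x = f y \<and> g x = g y \<longrightarrow> x = y"
    and v: "f v = 0" "g v \<noteq> 0" and ab: "f a \<noteq> f b"
  shows "{a + r *\<^sub>R (b - a) + s *\<^sub>R v | r s. 0 < r \<and> r < 1} =
    {x. min (f a) (f b) < f x \<and> f x < max (f a) (f b)}"
proof -
  note lin = linear_add[OF f] linear_diff[OF f] linear_scale[OF f]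
    linear_add[OF g] linear_diff[OF g] linear_scale[OF g]
  have between: "min (f a) (f b) < f a + r * (f b - f a) \<and> f a + r * (f b - f a) < max (f a) (f b)
      \<longleftrightarrow> 0 < r \<and> r < 1" for r
  proof (cases "f a < f b")
    case True
    have "f a + r * (f b - f a) < f b \<longleftrightarrow> r * (f b - f a) < 1 * (f b - f a)" by auto
    also have "\<dots> \<longleftrightarrow> r < 1" using True by (simp add: mult_less_cancel_right)
    finally show ?thesis using True by (simp add: zero_less_mult_iff)
  next
    case False
    with ab have *: "f b < f a" by simp
    have "f b < f a + r * (f b - f a) \<longleftrightarrow> r * (f a - f b) < 1 * (f a - f b)"
      by (auto simp: algebra_simps)
    also have "\<dots> \<longleftrightarrow> r < 1" using * by (simp add: mult_less_cancel_right)
    finally show ?thesis using * by (auto simp: mult_less_0_iff)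
  qed
  show ?thesis
  proof (intro set_eqI iffI)
    fix x assume "x \<in> {a + r *\<^sub>R (b - a) + s *\<^sub>R v | r s. 0 < r \<and> r < 1}"
    then obtain r s where "x = a + r *\<^sub>R (b - a) + s *\<^sub>R v" "0 < r \<and> r < 1" by blast
    then show "x \<in> {x. min (f a) (f b) < f x \<and> f x < max (f a) (f b)}"
      using between[of r] by (simp add: lin v)
  next
    fix x assume x: "x \<in> {x. min (f a) (f b) < f x \<and> f x < max (f a) (f b)}"
    define r where "r = (f x - f a) / (f b - f a)"
    define s where "s = (g x - g a - r * (g b - g a)) / g v"
    have fx: "f x = f a + r * (f b - f a)" using ab by (simp add: r_def)
    with x between[of r] have "0 < r \<and> r < 1" by simp
    moreover have "x = a + r *\<^sub>R (b - a) + s *\<^sub>R v"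
      by (rule inj[rule_format]) (use fx v in \<open>simp_all add: lin s_def\<close>)
    ultimately show "x \<in> {a + r *\<^sub>R (b - a) + s *\<^sub>R v | r s. 0 < r \<and> r < 1}" by blast
  qed
qed

lemma notin_line_iff:
  fixes f g :: "mink \<Rightarrow> real"
  assumes f: "linear f" and g: "linear g"
    and inj: "\<forall>x y. f x = f y \<and> g x = g y \<longrightarrow> x = y"
    and v: "f v = 0" "g v \<noteq> 0"
  shows "b \<notin> range (\<lambda>s. a + s *\<^sub>R v) \<longleftrightarrow> f a \<noteq> f b"
proof -
  note lin = linear_add[OF f] linear_scale[OF f] linear_add[OF g] linear_scale[OF g]
  have "b = a + ((g b - g a) / g v) *\<^sub>R v" if "f a = f b"
    by (rule inj[rule_format]) (use that v in \<open>simp_all add: lin\<close>)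
  then show ?thesis using v by (auto simp: lin)
qed

lemma lightlike_slab_iff:
  "lightlike_slab S \<longleftrightarrow> (\<exists>l r. l < r \<and> (S = null_box {l<..<r} UNIV \<or> S = null_box UNIV {l<..<r}))"
proof -
  note u = linear_ucoord linear_wcoord and w = linear_wcoord linear_ucoord
  have inj_u: "\<forall>x y. ucoord x = ucoord y \<and> wcoord x = wcoord y \<longrightarrow> x = y"
    and inj_w: "\<forall>x y. wcoord x = wcoord y \<and> ucoord x = ucoord y \<longrightarrow> x = y"
    using null_coords_eqI by blast+
  have u_slab: "{x. l < ucoord x \<and> ucoord x < r} = null_box {l<..<r} UNIV"
    and w_slab: "{x. l < wcoord x \<and> wcoord x < r} = null_box UNIV {l<..<r}" for l r
    by (auto simp: null_box_def)
  show ?thesis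
  proof
    assume "lightlike_slab S"
    then obtain a b v where v: "lightlike v" and b: "b \<notin> range (\<lambda>s. a + s *\<^sub>R v)"
      and S: "S = {a + r *\<^sub>R (b - a) + s *\<^sub>R v | r s. 0 < r \<and> r < 1}"
      unfolding lightlike_slab_def by blast
    have nz: "\<not> (ucoord v = 0 \<and> wcoord v = 0)"
      using v null_coords_eqI[of v 0] linear_0[OF linear_ucoord] linear_0[OF linear_wcoord]
      by (auto simp: lightlike_iff)
    from v consider "ucoord v = 0" | "wcoord v = 0" by (auto simp: lightlike_iff)
    then show "\<exists>l r. l < r \<and> (S = null_box {l<..<r} UNIV \<or> S = null_box UNIV {l<..<r})"
    proof cases
      case 1
      with nz have v': "wcoord v \<noteq> 0" by simp
      with b have ab: "ucoord a \<noteq> ucoord b" using notin_line_iff[OF u inj_u 1] by blast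
      have "S = null_box {min (ucoord a) (ucoord b)<..<max (ucoord a) (ucoord b)} UNIV"
        unfolding S affine_slab_eq[OF u inj_u 1 v' ab] u_slab ..
      moreover have "min (ucoord a) (ucoord b) < max (ucoord a) (ucoord b)" using ab by auto
      ultimately show ?thesis by blast
    next
      case 2
      with nz have v': "ucoord v \<noteq> 0" by simp
      with b have ab: "wcoord a \<noteq> wcoord b" using notin_line_iff[OF w inj_w 2] by blast
      have "S = null_box UNIV {min (wcoord a) (wcoord b)<..<max (wcoord a) (wcoord b)}"
        unfolding S affine_slab_eq[OF w inj_w 2 v' ab] w_slab ..
      moreover have "min (wcoord a) (wcoord b) < max (wcoord a) (wcoord b)" using ab by auto
      ultimately show ?thesis by blast
    qed
  next
    assume "\<exists>l r. l < r \<and> (S = null_box {l<..<r} UNIV \<or> S = null_box UNIV {l<..<r})"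
    then obtain l r where "l < r" and S: "S = null_box {l<..<r} UNIV \<or> S = null_box UNIV {l<..<r}"
      by blast
    from S show "lightlike_slab S"
    proof
      assume S: "S = null_box {l<..<r} UNIV"
      let ?a = "null_point l 0" and ?b = "null_point r 0" and ?v = "null_point 0 1"
      have v: "lightlike ?v" "ucoord ?v = 0" "wcoord ?v \<noteq> 0"
        by (auto simp: lightlike_iff null_point_def zero_prod_def ucoord_def wcoord_def)
      have ab: "ucoord ?a \<noteq> ucoord ?b" using \<open>l < r\<close> by simp
      have "?b \<notin> range (\<lambda>s. ?a + s *\<^sub>R ?v)"
        using notin_line_iff[OF u inj_u v(2,3)] ab by blast
      moreover have "S = {?a + r *\<^sub>R (?b - ?a) + s *\<^sub>R ?v | r s. 0 < r \<and> r < 1}"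
        unfolding affine_slab_eq[OF u inj_u v(2,3) ab] u_slab S using \<open>l < r\<close>
        by (simp add: min_def max_def)
      ultimately show ?thesis unfolding lightlike_slab_def using v(1) by blast
    next
      assume S: "S = null_box UNIV {l<..<r}"
      let ?a = "null_point 0 l" and ?b = "null_point 0 r" and ?v = "null_point 1 0"
      have v: "lightlike ?v" "wcoord ?v = 0" "ucoord ?v \<noteq> 0"
        by (auto simp: lightlike_iff null_point_def zero_prod_def ucoord_def wcoord_def)
      have ab: "wcoord ?a \<noteq> wcoord ?b" using \<open>l < r\<close> by simp
      have "?b \<notin> range (\<lambda>s. ?a + s *\<^sub>R ?v)"
        using notin_line_iff[OF w inj_w v(2,3)] ab by blast
      moreover have "S = {?a + r *\<^sub>R (?b - ?a) + s *\<^sub>R ?v | r s. 0 < r \<and> r < 1}"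
        unfolding affine_slab_eq[OF w inj_w v(2,3) ab] w_slab S using \<open>l < r\<close>
        by (simp add: min_def max_def)
      ultimately show ?thesis unfolding lightlike_slab_def using v(1) by blast
    qed
  qed
qed

lemma proper_open_interval_Int:
  assumes "proper_open_interval P" "open P'" "convex P'" "P \<inter> P' \<noteq> {}"
  shows "proper_open_interval (P \<inter> P')" "proper_open_interval (P' \<inter> P)"
  using assms by (auto simp: proper_open_interval_def convex_Int Int_commute)

lemma half_lightlike_slab_imp_null_box:
  assumes "half_lightlike_slab \<Omega>"
  shows "\<exists>P Q. proper_open_interval P \<and> proper_open_interval Q \<and> \<Omega> = null_box P Q"
proof -
  from assms obtain S x where "\<Omega> \<noteq> {}" and S: "lightlike_slab S"
    and "\<Omega> = S \<inter> chron_future x \<or> \<Omega> = S \<inter> chron_past x"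
    unfolding half_lightlike_slab_def by blast
  then obtain P Q where PQ: "proper_open_interval P" "proper_open_interval Q"
    and \<Omega>: "\<Omega> = S \<inter> null_box P Q"
    unfolding chron_future_null chron_past_null using proper_open_interval_halfline by blast
  from S obtain P' Q' where "open P'" "convex P'" "open Q'" "convex Q'" "S = null_box P' Q'"
    unfolding lightlike_slab_iff
    by (metis convex_UNIV convex_real_interval(8) open_UNIV open_greaterThanLessThan)
  with \<Omega> have eq: "\<Omega> = null_box (P' \<inter> P) (Q' \<inter> Q)" by (simp add: null_box_Int)
  with \<open>\<Omega> \<noteq> {}\<close> have "P \<inter> P' \<noteq> {}" "Q \<inter> Q' \<noteq> {}"
    by (simp_all add: null_box_empty_iff Int_commute)
  then have "proper_open_interval (P' \<inter> P)" "proper_open_interval (Q' \<inter> Q)"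
    using proper_open_interval_Int(2) PQ \<open>open P'\<close> \<open>convex P'\<close> \<open>open Q'\<close> \<open>convex Q'\<close> by simp_all
  with eq show ?thesis by blast
qed

definition special_domain :: "mink set \<Rightarrow> bool" where
  "special_domain \<Omega> \<longleftrightarrow> diamond \<Omega> \<or> space_component \<Omega> \<or> (\<exists>x. \<Omega> = chron_future x) \<or>
     (\<exists>x. \<Omega> = chron_past x) \<or> half_lightlike_slab \<Omega>"

text \<open>Each factor is bounded or one of two kinds of half line. Two bounded factors give a
  diamond, exactly one a half lightlike slab, and none a future, a past or one of the two types of
  space component.\<close>

lemma special_domain_iff_null_box:
  "special_domain \<Omega> \<longleftrightarrow>
    (\<exists>P Q. proper_open_interval P \<and> proper_open_interval Q \<and> \<Omega> = null_box P Q)"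
proof
  assume "special_domain \<Omega>"
  then consider "diamond \<Omega>" | "space_component \<Omega>" | "\<exists>x. \<Omega> = chron_future x"
    | "\<exists>x. \<Omega> = chron_past x" | "half_lightlike_slab \<Omega>"
    unfolding special_domain_def by blast
  then show "\<exists>P Q. proper_open_interval P \<and> proper_open_interval Q \<and> \<Omega> = null_box P Q"
  proof cases
    case 1
    then show ?thesis unfolding diamond_iff using proper_open_interval_greaterThanLessThan by blast
  next
    case 2
    then show ?thesis unfolding space_component_iff using proper_open_interval_halfline by blast
  next
    case 3
    then show ?thesis unfolding chron_future_null using proper_open_interval_halfline by blast
  next
    case 4
    then show ?thesis unfolding chron_past_null using proper_open_interval_halfline by blast
  next
    case 5
    then show ?thesis by (rule half_lightlike_slab_imp_null_box)
  qed
next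
  have future: "null_box {l<..} {l'<..} = chron_future (null_point l l')"
    and past: "null_box {..<l} {..<l'} = chron_past (null_point l l')" for l l'
    by (simp_all add: chron_future_null chron_past_null)
  have half: "half_lightlike_slab (S \<inter> T)"
    if "lightlike_slab S" "(\<exists>x. T = chron_future x) \<or> (\<exists>x. T = chron_past x)" "S \<inter> T \<noteq> {}" for S T
    using that unfolding half_lightlike_slab_def by blast
  have slab: "lightlike_slab (null_box {l<..<r} UNIV)" "lightlike_slab (null_box UNIV {l<..<r})"
    if "l < r" for l r
    using that unfolding lightlike_slab_iff by blast+
  assume "\<exists>P Q. proper_open_interval P \<and> proper_open_interval Q \<and> \<Omega> = null_box P Q"
  then obtain P Q where P: "proper_open_interval P" and Q: "proper_open_interval Q"
    and \<Omega>: "\<Omega> = null_box P Q" by blast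
  have ne: "\<Omega> \<noteq> {}" using P Q by (simp add: \<Omega> null_box_empty_iff proper_open_interval_def)
  have half_u: "special_domain \<Omega>"
    if "\<Omega> = null_box {l<..<r} UNIV \<inter> T" "l < r" "(\<exists>x. T = chron_future x) \<or> (\<exists>x. T = chron_past x)"
    for l r T
    using half[OF slab(1)[OF that(2)] that(3)] ne that(1) by (simp add: special_domain_def)
  have half_w: "special_domain \<Omega>"
    if "\<Omega> = null_box UNIV {l<..<r} \<inter> T" "l < r" "(\<exists>x. T = chron_future x) \<or> (\<exists>x. T = chron_past x)"
    for l r T
    using half[OF slab(2)[OF that(2)] that(3)] ne that(1) by (simp add: special_domain_def)
  show "special_domain \<Omega>"
  proof (cases rule: proper_open_interval_cases[OF P])
    case P: (1 l)
    show ?thesis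
    proof (cases rule: proper_open_interval_cases[OF Q])
      case (1 l')
      with P \<Omega> future have "\<Omega> = chron_future (null_point l l')" by simp
      then have "\<exists>x. \<Omega> = chron_future x" by blast
      then show ?thesis by (simp add: special_domain_def)
    next
      case (2 r')
      with P \<Omega> have "space_component \<Omega>" unfolding space_component_iff by blast
      then show ?thesis by (simp add: special_domain_def)
    next
      case (3 l' r')
      \<comment> \<open>The future of the point with null coordinates \<open>l\<close> and
        \<open>l'\<close> cuts only the first coordinate; on the second the slab is already
        stricter. The other slab cases follow the same pattern.\<close>
      then have "\<Omega> = null_box UNIV {l'<..<r'} \<inter> null_box {l<..} {l'<..}"
        by (auto simp: \<Omega> P null_box_def)
      from half_w[OF this 3(1)] future show ?thesis by blast
    qed
  next
    case P: (2 r)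
    show ?thesis
    proof (cases rule: proper_open_interval_cases[OF Q])
      case (1 l')
      with P \<Omega> have "space_component \<Omega>" unfolding space_component_iff by blast
      then show ?thesis by (simp add: special_domain_def)
    next
      case (2 r')
      with P \<Omega> past have "\<Omega> = chron_past (null_point r r')" by simp
      then have "\<exists>x. \<Omega> = chron_past x" by blast
      then show ?thesis by (simp add: special_domain_def)
    next
      case (3 l' r')
      then have "\<Omega> = null_box UNIV {l'<..<r'} \<inter> null_box {..<r} {..<r'}"
        by (auto simp: \<Omega> P null_box_def)
      from half_w[OF this 3(1)] past show ?thesis by blast
    qed
  next
    case P: (3 l r)
    show ?thesis
    proof (cases rule: proper_open_interval_cases[OF Q])
      case (1 l')
      then have "\<Omega> = null_box {l<..<r} UNIV \<inter> null_box {l<..} {l'<..}"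
        by (auto simp: \<Omega> P null_box_def)
      from half_u[OF this P(1)] future show ?thesis by blast
    next
      case (2 r')
      then have "\<Omega> = null_box {l<..<r} UNIV \<inter> null_box {..<r} {..<r'}"
        by (auto simp: \<Omega> P null_box_def)
      from half_u[OF this P(1)] past show ?thesis by blast
    next
      case (3 l' r')
      with P \<Omega> have "diamond \<Omega>" unfolding diamond_iff by blast
      then show ?thesis by (simp add: special_domain_def)
    qed
  qed
qed

section \<open>Moebius transformations\<close>

text \<open>\<open>F\<close> carries the leaves of the foliation by levels of \<open>g\<close> into
  leaves of the one by levels of \<open>f\<close>, distinct leaves into distinct ones. This record
  of a partial map survives composition without any formula for it.\<close>

definition same_fibres :: "(mink \<Rightarrow> real) \<Rightarrow> (mink \<Rightarrow> real) \<Rightarrow> (mink \<Rightarrow> mink option) \<Rightarrow> bool" where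
  "same_fibres f g F \<longleftrightarrow>
     (\<forall>x\<in>dom F. \<forall>y\<in>dom F. f (the (F x)) = f (the (F y)) \<longleftrightarrow> g x = g y)"

lemma same_fibresD:
  "same_fibres f g F \<Longrightarrow> x \<in> dom F \<Longrightarrow> y \<in> dom F \<Longrightarrow>
    f (the (F x)) = f (the (F y)) \<longleftrightarrow> g x = g y"
  by (simp add: same_fibres_def)

lemma same_fibres_comp:
  assumes "same_fibres f g F" "same_fibres g h G"
  shows "same_fibres f h (F \<circ>\<^sub>m G)"
  unfolding same_fibres_def
proof (intro ballI)
  have lift: "\<exists>x'. G x = Some x' \<and> x' \<in> dom F" if "x \<in> dom (F \<circ>\<^sub>m G)" for x
    using that by (cases "G x") (auto simp: map_comp_def)
  fix x y assume "x \<in> dom (F \<circ>\<^sub>m G)" "y \<in> dom (F \<circ>\<^sub>m G)"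
  then obtain x' y' where G: "G x = Some x'" "x' \<in> dom F" "G y = Some y'" "y' \<in> dom F"
    using lift by blast
  then have "f (the (F x')) = f (the (F y')) \<longleftrightarrow> g x' = g y'"
    by (intro same_fibresD[OF assms(1)])
  moreover have "g (the (G x)) = g (the (G y)) \<longleftrightarrow> h x = h y"
    using G by (intro same_fibresD[OF assms(2)]) auto
  ultimately show "f (the ((F \<circ>\<^sub>m G) x)) = f (the ((F \<circ>\<^sub>m G) y)) \<longleftrightarrow> h x = h y"
    using G by (simp add: map_comp_def)
qed

text \<open>The null basis goes to null vectors, so the image of each basis vector has a vanishing
  coordinate; the mixed product \<open>\<alpha> * \<delta> + \<gamma> * \<beta> = 1\<close> then
  leaves only a diagonal or an antidiagonal matrix.\<close>

lemma isometry_null: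
  assumes A: "linear A" and iso: "\<And>v w. mform (A v) (A w) = mform v w"
  shows "(\<forall>v. (ucoord (A v) = 0 \<longleftrightarrow> ucoord v = 0) \<and> (wcoord (A v) = 0 \<longleftrightarrow> wcoord v = 0)) \<or>
    (\<forall>v. (ucoord (A v) = 0 \<longleftrightarrow> wcoord v = 0) \<and> (wcoord (A v) = 0 \<longleftrightarrow> ucoord v = 0))"
proof -
  let ?e = "null_point 1 0" and ?e' = "null_point 0 1"
  have form: "mform v w = - (ucoord v * wcoord w + wcoord v * ucoord w) / 2" for v w
    by (simp add: mform_def ucoord_def wcoord_def field_simps)
  define \<alpha> \<beta> \<gamma> \<delta> where "\<alpha> = ucoord (A ?e)" and "\<beta> = ucoord (A ?e')"
    and "\<gamma> = wcoord (A ?e)" and "\<delta> = wcoord (A ?e')"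
  note defs = \<alpha>_def \<beta>_def \<gamma>_def \<delta>_def
  have decomp: "v = ucoord v *\<^sub>R ?e + wcoord v *\<^sub>R ?e'" for v
    by (rule null_coords_eqI) (simp_all add: linear_add[OF linear_ucoord] linear_add[OF linear_wcoord]
        linear_scale[OF linear_ucoord] linear_scale[OF linear_wcoord])
  have coords: "ucoord (A v) = ucoord v * \<alpha> + wcoord v * \<beta>"
    "wcoord (A v) = ucoord v * \<gamma> + wcoord v * \<delta>" for v
  proof -
    have "A v = A (ucoord v *\<^sub>R ?e + wcoord v *\<^sub>R ?e')" by (rule arg_cong, rule decomp)
    also have "\<dots> = ucoord v *\<^sub>R A ?e + wcoord v *\<^sub>R A ?e'"
      by (simp only: linear_add[OF A] linear_scale[OF A])
    finally have "ucoord (A v) = ucoord (ucoord v *\<^sub>R A ?e + wcoord v *\<^sub>R A ?e')"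
      "wcoord (A v) = wcoord (ucoord v *\<^sub>R A ?e + wcoord v *\<^sub>R A ?e')" by (rule arg_cong)+
    then show "ucoord (A v) = ucoord v * \<alpha> + wcoord v * \<beta>"
      "wcoord (A v) = ucoord v * \<gamma> + wcoord v * \<delta>"
      by (simp_all only: defs linear_add[OF linear_ucoord] linear_add[OF linear_wcoord]
          linear_scale[OF linear_ucoord] linear_scale[OF linear_wcoord] real_scaleR_def)
  qed
  have prods: "\<alpha> * \<gamma> = 0" "\<beta> * \<delta> = 0" "\<alpha> * \<delta> + \<gamma> * \<beta> = 1"
    using iso[of ?e ?e] iso[of ?e' ?e'] iso[of ?e ?e'] by (simp_all add: form coords mult.commute)
  show ?thesis
  proof (cases "\<alpha> = 0")
    case True
    with prods have "\<gamma> \<noteq> 0" "\<beta> \<noteq> 0" "\<delta> = 0" by auto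
    then show ?thesis using True by (simp add: coords)
  next
    case False
    with prods have "\<gamma> = 0" "\<delta> \<noteq> 0" "\<beta> = 0" by auto
    then show ?thesis using False by (simp add: coords)
  qed
qed

text \<open>Division by \<open>mform x x\<close>, which is minus the product of the null
  coordinates, cancels each coordinate and leaves the reciprocal of the other; hence the
  exchange.\<close>

lemma inversion_coords:
  assumes "ucoord x \<noteq> 0" "wcoord x \<noteq> 0"
  shows "inversion x = Some (null_point (- 1 / wcoord x) (- 1 / ucoord x))"
proof -
  define c where "c = inverse (- (ucoord x * wcoord x))"
  have "ucoord (c *\<^sub>R x) = c * ucoord x" "wcoord (c *\<^sub>R x) = c * wcoord x"
    by (simp_all add: linear_scale[OF linear_ucoord] linear_scale[OF linear_wcoord])
  moreover have "c * ucoord x = - 1 / wcoord x" "c * wcoord x = - 1 / ucoord x"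
    using assms by (simp_all add: c_def field_simps)
  ultimately have "c *\<^sub>R x = null_point (- 1 / wcoord x) (- 1 / ucoord x)"
    by (intro null_coords_eqI) simp_all
  then show ?thesis using assms by (simp add: inversion_def mform_null c_def)
qed

lemma dom_inversion: "x \<in> dom inversion \<longleftrightarrow> ucoord x \<noteq> 0 \<and> wcoord x \<noteq> 0"
  by (auto simp: inversion_def mform_null split: if_splits)

lemma mobius_fibres:
  assumes "mobius F"
  shows "(same_fibres ucoord ucoord F \<and> same_fibres wcoord wcoord F) \<or>
    (same_fibres ucoord wcoord F \<and> same_fibres wcoord ucoord F)"
  using assms
proof induction
  case (similarity f)
  then obtain l A b where "l > 0" and A: "linear A" "\<And>v w. mform (A v) (A w) = mform v w"
    and f: "f = (\<lambda>x. l *\<^sub>R A x + b)"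
    unfolding similarity_def by blast
  have iff: "ucoord (f x) = ucoord (f y) \<longleftrightarrow> ucoord (A (x - y)) = 0"
    "wcoord (f x) = wcoord (f y) \<longleftrightarrow> wcoord (A (x - y)) = 0" for x y
  proof -
    have "f x = f y + l *\<^sub>R A (x - y)"
      by (simp add: f linear_diff[OF A(1)] scaleR_diff_right)
    then have "ucoord (f x) = ucoord (f y) + l * ucoord (A (x - y))"
      "wcoord (f x) = wcoord (f y) + l * wcoord (A (x - y))"
      by (simp_all only: linear_add[OF linear_ucoord] linear_add[OF linear_wcoord]
          linear_scale[OF linear_ucoord] linear_scale[OF linear_wcoord] real_scaleR_def)
    then show "ucoord (f x) = ucoord (f y) \<longleftrightarrow> ucoord (A (x - y)) = 0"
      "wcoord (f x) = wcoord (f y) \<longleftrightarrow> wcoord (A (x - y)) = 0"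
      using \<open>l > 0\<close> by simp_all
  qed
  have diff: "ucoord (x - y) = 0 \<longleftrightarrow> ucoord x = ucoord y" "wcoord (x - y) = 0 \<longleftrightarrow> wcoord x = wcoord y"
    for x y by (simp_all add: linear_diff[OF linear_ucoord] linear_diff[OF linear_wcoord])
  from isometry_null[OF A] show ?case
  proof
    assume "\<forall>v. (ucoord (A v) = 0 \<longleftrightarrow> ucoord v = 0) \<and> (wcoord (A v) = 0 \<longleftrightarrow> wcoord v = 0)"
    then have "same_fibres ucoord ucoord (\<lambda>x. Some (f x))" "same_fibres wcoord wcoord (\<lambda>x. Some (f x))"
      unfolding same_fibres_def option.sel iff using diff by blast+
    then show ?case by blast
  next
    assume "\<forall>v. (ucoord (A v) = 0 \<longleftrightarrow> wcoord v = 0) \<and> (wcoord (A v) = 0 \<longleftrightarrow> ucoord v = 0)"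
    then have "same_fibres ucoord wcoord (\<lambda>x. Some (f x))" "same_fibres wcoord ucoord (\<lambda>x. Some (f x))"
      unfolding same_fibres_def option.sel iff using diff by blast+
    then show ?case by blast
  qed
next
  case inversion
  have "ucoord (the (inversion x)) = - 1 / wcoord x" "wcoord (the (inversion x)) = - 1 / ucoord x"
    if "x \<in> dom inversion" for x
    using that unfolding dom_inversion by (simp_all add: inversion_coords)
  then have "same_fibres ucoord wcoord inversion" "same_fibres wcoord ucoord inversion"
    unfolding same_fibres_def by simp_all
  then show ?case by blast
next
  case (comp F G)
  from comp.IH show ?case
    by (elim disjE conjE) (simp_all add: same_fibres_comp)
qed

text \<open>A product is a set that contains, with \<open>x\<close> and \<open>y\<close>, the point
  with the first coordinate of \<open>x\<close> and the second of \<open>y\<close>. That point is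
  found by mixing the coordinates of the images in the target box and pulling back along the
  fibres.\<close>

lemma mobius_image_null_box:
  assumes F: "mobius F" "\<Omega> \<subseteq> dom F" and im: "(\<lambda>x. the (F x)) ` \<Omega> = null_box A B"
  shows "\<Omega> = null_box (ucoord ` \<Omega>) (wcoord ` \<Omega>)"
proof
  show "\<Omega> \<subseteq> null_box (ucoord ` \<Omega>) (wcoord ` \<Omega>)" by (auto simp: null_box_def)
  show "null_box (ucoord ` \<Omega>) (wcoord ` \<Omega>) \<subseteq> \<Omega>"
  proof
    fix z assume "z \<in> null_box (ucoord ` \<Omega>) (wcoord ` \<Omega>)"
    then obtain x y where xy: "x \<in> \<Omega>" "y \<in> \<Omega>" "ucoord z = ucoord x" "wcoord z = wcoord y"
      by (auto simp: null_box_def)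
    then have dom: "x \<in> dom F" "y \<in> dom F" using F(2) by blast+
    have "the (F x) \<in> null_box A B" "the (F y) \<in> null_box A B"
      using im xy(1,2) by blast+
    then have mem: "ucoord (the (F x)) \<in> A" "wcoord (the (F x)) \<in> B"
      "ucoord (the (F y)) \<in> A" "wcoord (the (F y)) \<in> B"
      by (simp_all add: null_box_def)
    have pre: "\<exists>v\<in>\<Omega>. the (F v) = null_point a b" if "a \<in> A" "b \<in> B" for a b
    proof -
      have "null_point a b \<in> (\<lambda>x. the (F x)) ` \<Omega>" using that im by simp
      then show ?thesis by (rule imageE) (auto intro: bexI)
    qed
    have "\<exists>v\<in>\<Omega>. ucoord v = ucoord x \<and> wcoord v = wcoord y"
      using mobius_fibres[OF F(1)]
    proof
      assume *: "same_fibres ucoord ucoord F \<and> same_fibres wcoord wcoord F"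
      from pre[OF mem(1,4)] obtain v where v: "v \<in> \<Omega>"
        "the (F v) = null_point (ucoord (the (F x))) (wcoord (the (F y)))" by (rule bexE)
      then have "v \<in> dom F" using F(2) by blast
      with * v dom have "ucoord v = ucoord x" "wcoord v = wcoord y"
        using same_fibresD[of ucoord ucoord F v x] same_fibresD[of wcoord wcoord F v y] by simp_all
      with v show ?thesis by blast
    next
      \<comment> \<open>When \<open>F\<close> exchanges the foliations, the images are mixed the
        other way round.\<close>
      assume *: "same_fibres ucoord wcoord F \<and> same_fibres wcoord ucoord F"
      from pre[OF mem(3,2)] obtain v where v: "v \<in> \<Omega>"
        "the (F v) = null_point (ucoord (the (F y))) (wcoord (the (F x)))" by (rule bexE)
      then have "v \<in> dom F" using F(2) by blast
      with * v dom have "ucoord v = ucoord x" "wcoord v = wcoord y"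
        using same_fibresD[of ucoord wcoord F v y] same_fibresD[of wcoord ucoord F v x] by simp_all
      with v show ?thesis by blast
    qed
    then obtain v where "v \<in> \<Omega>" "ucoord v = ucoord z" "wcoord v = wcoord z"
      using xy by auto
    then show "z \<in> \<Omega>" using null_coords_eqI[of v z] by simp
  qed
qed

text \<open>The translation places 0 outside the interval at distance 1 from one end, where
  \<open>- 1 / a\<close> is monotone and bounded; an infinite end goes to 0.\<close>

lemma proper_open_interval_inversion:
  assumes "proper_open_interval P"
  obtains \<tau> l r where "l < r" "\<And>a. a \<in> P \<Longrightarrow> a + \<tau> \<noteq> 0" "(\<lambda>a. - 1 / (a + \<tau>)) ` P = {l<..<r}"
proof -
  have image: "(\<lambda>a. - 1 / (a + \<tau>)) ` P = {l<..<r}"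
    if "\<And>a. a \<in> P \<Longrightarrow> - 1 / (a + \<tau>) \<in> {l<..<r}"
      and "\<And>b. b \<in> {l<..<r} \<Longrightarrow> b \<noteq> 0 \<and> - 1 / b - \<tau> \<in> P" for \<tau> l r
  proof
    show "{l<..<r} \<subseteq> (\<lambda>a. - 1 / (a + \<tau>)) ` P"
    proof
      fix b assume b: "b \<in> {l<..<r}"
      with that(2) have "- 1 / b - \<tau> \<in> P" by blast
      then have "- 1 / ((- 1 / b - \<tau>) + \<tau>) \<in> (\<lambda>a. - 1 / (a + \<tau>)) ` P" by (rule imageI)
      then show "b \<in> (\<lambda>a. - 1 / (a + \<tau>)) ` P" using that(2)[OF b] by simp
    qed
  qed (use that(1) in blast)
  from assms show thesis
  proof (cases rule: proper_open_interval_cases)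
    case (1 l)
    show thesis
    proof (rule that[of "-1" 0 "1 - l"])
      show "(\<lambda>a. - 1 / (a + (1 - l))) ` P = {-1<..<0}"
        by (rule image) (auto simp: 1 field_simps)
    qed (auto simp: 1)
  next
    case (2 r)
    show thesis
    proof (rule that[of 0 1 "- 1 - r"])
      show "(\<lambda>a. - 1 / (a + (- 1 - r))) ` P = {0<..<1}"
        by (rule image) (auto simp: 2 field_simps)
    qed (auto simp: 2)
  next
    case (3 l r)
    show thesis
    proof (rule that[of "-1" "- 1 / (1 + r - l)" "1 - l"])
      show "-1 < - 1 / (1 + r - l)" using 3 by (simp add: field_simps)
      show "(\<lambda>a. - 1 / (a + (1 - l))) ` P = {-1<..<- 1 / (1 + r - l)}"
      proof (rule image)
        fix a assume "a \<in> P"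
        then show "- 1 / (a + (1 - l)) \<in> {-1<..<- 1 / (1 + r - l)}"
          using 3 by (simp add: field_simps)
      next
        fix b assume b: "b \<in> {-1<..<- 1 / (1 + r - l)}"
        then have "b < - 1 / (1 + r - l)" by simp
        also have "\<dots> < 0" using 3 by (intro divide_neg_pos) auto
        finally have "b < 0" .
        with b 3 show "b \<noteq> 0 \<and> - 1 / b - (1 - l) \<in> P" by (simp add: field_simps)
      qed
    qed (auto simp: 3)
  qed
qed

lemma null_box_mobius_diamond:
  assumes "proper_open_interval P" "proper_open_interval Q"
  shows "\<exists>D. diamond D \<and> mobius_equivalent (null_box P Q) D"
proof -
  obtain \<tau> l r where P: "l < r" "\<And>a. a \<in> P \<Longrightarrow> a + \<tau> \<noteq> 0" "(\<lambda>a. - 1 / (a + \<tau>)) ` P = {l<..<r}"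
    by (rule proper_open_interval_inversion[OF assms(1)]) (rule that)
  obtain \<tau>' l' r' where Q: "l' < r'" "\<And>a. a \<in> Q \<Longrightarrow> a + \<tau>' \<noteq> 0"
    "(\<lambda>a. - 1 / (a + \<tau>')) ` Q = {l'<..<r'}"
    by (rule proper_open_interval_inversion[OF assms(2)]) (rule that)
  define t where "t = null_point \<tau> \<tau>'"
  define F where "F = inversion \<circ>\<^sub>m (\<lambda>x. Some (x + t))"
  \<comment> \<open>The factors change places because the inversion exchanges the null
    coordinates.\<close>
  let ?D = "null_box {l'<..<r'} {l<..<r}"
  have sim: "similarity (\<lambda>x. x + t)"
    unfolding similarity_def by (intro exI[of _ 1] exI[of _ id] exI[of _ t]) (simp add: linear_id)
  have F: "mobius F"
    unfolding F_def by (rule mobius.comp[OF mobius.inversion mobius.similarity[OF sim]])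
  have Fx: "F x = Some (null_point (- 1 / (wcoord x + \<tau>')) (- 1 / (ucoord x + \<tau>)))"
    if "x \<in> null_box P Q" for x
  proof -
    have "ucoord (x + t) = ucoord x + \<tau>" "wcoord (x + t) = wcoord x + \<tau>'"
      by (simp_all add: t_def linear_add[OF linear_ucoord] linear_add[OF linear_wcoord])
    moreover from this have "ucoord (x + t) \<noteq> 0" "wcoord (x + t) \<noteq> 0"
      using that P(2) Q(2) by (simp_all add: null_box_def)
    ultimately show ?thesis by (simp add: F_def map_comp_def inversion_coords)
  qed
  have "bij_betw (\<lambda>x. the (F x)) (null_box P Q) ?D"
    unfolding bij_betw_def
  proof
    show "inj_on (\<lambda>x. the (F x)) (null_box P Q)"
    proof (rule inj_onI)
      fix x y assume xy: "x \<in> null_box P Q" "y \<in> null_box P Q" and "the (F x) = the (F y)"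
      then have "null_point (- 1 / (wcoord x + \<tau>')) (- 1 / (ucoord x + \<tau>)) =
          null_point (- 1 / (wcoord y + \<tau>')) (- 1 / (ucoord y + \<tau>))"
        by (simp add: Fx)
      from arg_cong[OF this, of ucoord] arg_cong[OF this, of wcoord] show "x = y"
        by (intro null_coords_eqI) simp_all
    qed
    show "(\<lambda>x. the (F x)) ` null_box P Q = ?D"
    proof
      show "(\<lambda>x. the (F x)) ` null_box P Q \<subseteq> ?D"
      proof (rule image_subsetI)
        fix x assume x: "x \<in> null_box P Q"
        then have "ucoord x \<in> P" "wcoord x \<in> Q" by (simp_all add: null_box_def)
        from imageI[OF this(1), of "\<lambda>a. - 1 / (a + \<tau>)"] imageI[OF this(2), of "\<lambda>a. - 1 / (a + \<tau>')"]
        have "- 1 / (ucoord x + \<tau>) \<in> {l<..<r}" "- 1 / (wcoord x + \<tau>') \<in> {l'<..<r'}"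
          by (simp_all only: P(3) Q(3))
        then show "the (F x) \<in> ?D" using x by (simp add: Fx)
      qed
      show "?D \<subseteq> (\<lambda>x. the (F x)) ` null_box P Q"
      proof
        fix y assume "y \<in> ?D"
        then have "wcoord y \<in> {l<..<r}" "ucoord y \<in> {l'<..<r'}" by (simp_all add: null_box_def)
        then obtain a b where ab: "a \<in> P" "b \<in> Q"
          and "ucoord y = - 1 / (b + \<tau>')" "wcoord y = - 1 / (a + \<tau>)"
          unfolding P(3)[symmetric] Q(3)[symmetric] by (elim imageE) (rule that)
        then have "y = the (F (null_point a b))"
          by (intro null_coords_eqI) (simp_all add: Fx)
        with ab show "y \<in> (\<lambda>x. the (F x)) ` null_box P Q"
          by (intro image_eqI[of _ _ "null_point a b"]) simp_all
      qed
    qed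
  qed
  moreover have "null_box P Q \<subseteq> dom F" using Fx by blast
  moreover have "diamond ?D" using P(1) Q(1) unfolding diamond_iff by blast
  ultimately show ?thesis using F unfolding mobius_equivalent_def by blast
qed

section \<open>The four conditions compared with the product condition\<close>

theorem theorem10p2:
  fixes \<Omega> :: "mink set"
  assumes "domain \<Omega>" and "convex \<Omega>" and "contains_no_line \<Omega>"
  shows "(markowitz_hilbert_equivalent \<Omega> \<longleftrightarrow>
            quasi_isometrically_equivalent \<Omega> (markowitz \<Omega>) (hilbert \<Omega>)) \<and>
         (quasi_isometrically_equivalent \<Omega> (markowitz \<Omega>) (hilbert \<Omega>) \<longleftrightarrow>
            (\<exists>D. diamond D \<and> mobius_equivalent \<Omega> D)) \<and>
         ((\<exists>D. diamond D \<and> mobius_equivalent \<Omega> D) \<longleftrightarrow>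
            diamond \<Omega> \<or> space_component \<Omega> \<or> (\<exists>x. \<Omega> = chron_future x) \<or>
            (\<exists>x. \<Omega> = chron_past x) \<or> half_lightlike_slab \<Omega>)"
proof -
  define box where
    "box \<longleftrightarrow> (\<exists>P Q. proper_open_interval P \<and> proper_open_interval Q \<and> \<Omega> = null_box P Q)"
  have \<Omega>: "open \<Omega>" "\<Omega> \<noteq> {}" using assms(1) by (simp_all add: domain_def)
  have boxI: "box" if "\<Omega> = null_box (ucoord ` \<Omega>) (wcoord ` \<Omega>)"
    using proper_open_interval_coords[OF that \<Omega>(1) assms(2) \<Omega>(2) assms(3)] that
    unfolding box_def by blast
  have "markowitz_hilbert_equivalent \<Omega> \<longleftrightarrow> box"
  proof
    assume "markowitz_hilbert_equivalent \<Omega>"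
    then obtain \<alpha> where "\<alpha> \<ge> 1"
      and le: "\<And>x y. x \<in> \<Omega> \<Longrightarrow> y \<in> \<Omega> \<Longrightarrow> markowitz \<Omega> x y \<le> \<alpha> * hilbert \<Omega> x y"
      unfolding markowitz_hilbert_equivalent_def by blast
    show box
    proof (rule boxI, rule comparison_imp_null_box[OF \<Omega>(1) assms(2)])
      show "0 \<le> \<alpha>" using \<open>\<alpha> \<ge> 1\<close> by simp
      show "markowitz \<Omega> x y \<le> \<alpha> * hilbert \<Omega> x y + 0" if "x \<in> \<Omega>" "y \<in> \<Omega>" for x y
        using le[OF that] by simp
    qed
  qed (use null_box_equivalent(1) box_def in blast)
  moreover have "quasi_isometrically_equivalent \<Omega> (markowitz \<Omega>) (hilbert \<Omega>) \<longleftrightarrow> box"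
  proof
    assume "quasi_isometrically_equivalent \<Omega> (markowitz \<Omega>) (hilbert \<Omega>)"
    then obtain \<alpha> \<beta> where "\<alpha> > 0"
      and le: "\<And>x y. x \<in> \<Omega> \<Longrightarrow> y \<in> \<Omega> \<Longrightarrow> 1 / \<alpha> * markowitz \<Omega> x y - \<beta> \<le> hilbert \<Omega> x y"
      unfolding quasi_isometrically_equivalent_def by blast
    show box
    proof (rule boxI, rule comparison_imp_null_box[OF \<Omega>(1) assms(2)])
      show "0 \<le> \<alpha>" using \<open>\<alpha> > 0\<close> by simp
      show "markowitz \<Omega> x y \<le> \<alpha> * hilbert \<Omega> x y + \<alpha> * \<beta>" if "x \<in> \<Omega>" "y \<in> \<Omega>" for x y
        using le[OF that] \<open>\<alpha> > 0\<close> by (simp add: field_simps)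
    qed
  qed (use null_box_equivalent(2) box_def in blast)
  moreover have "(\<exists>D. diamond D \<and> mobius_equivalent \<Omega> D) \<longleftrightarrow> box"
  proof
    assume "\<exists>D. diamond D \<and> mobius_equivalent \<Omega> D"
    then obtain F A B where "mobius F" "\<Omega> \<subseteq> dom F" "(\<lambda>x. the (F x)) ` \<Omega> = null_box A B"
      unfolding diamond_iff mobius_equivalent_def bij_betw_def by blast
    then show box by (intro boxI mobius_image_null_box)
  qed (use null_box_mobius_diamond box_def in blast)
  moreover have "special_domain \<Omega> \<longleftrightarrow> box"
    unfolding box_def by (rule special_domain_iff_null_box)
  ultimately show ?thesis unfolding special_domain_def by blast
qed

end
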